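(* Fix a prime $p$, and for each $N \in \mathbb{Z}_{\geq 1}$ let $A_i^{(N)}$, $i \geq 1$, be independent, uniformly distributed elements of $\mathrm{Mat}_N(\mathbb{F}_p)$. Let $(s_N)_{N \geq 1}$ be any sequence of natural numbers such that $s_N \to \infty$ and $N - \log_p s_N \to \infty$ as $N \to \infty$. Then the sequence of $\mathbb{Z}$-valued random variables $$X_N^{(1)} := \mathrm{corank}(A_{s_N}^{(N)} \cdots A_2^{(N)} A_1^{(N)}) - \lfloor \log_p s_N \rfloor, \qquad N = 1,2,\ldots$$ satisfies $$\lim_{N \to \infty} D_\infty\left(X_N^{(1)}, \mathcal{L}^{(1)}_{p^{-1},\, p^{\{\log_p s_N\}}/(p-1)}\right) = 0.$$
   Context: Notation: $(a;t)_n = \prod_{i=1}^n (1-at^{i-1})$ for $n \in \mathbb{Z}_{\ge 0} \cup \{\infty\}$. $\{x\} = x - \lfloor x \rfloor$ is the fractional part of a real number $x$. The corank of an $N\times N$ matrix is $N$ minus its rank. For $t \in (0,1)$ and $\chi \in \mathbb{R}_{>0}$, $\mathcal{L}^{(1)}_{t,\chi}$ is the $\mathbb{Z}$-valued random variable with $$\Pr(\mathcal{L}_{t,\chi}^{(1)} = x) = \frac{1}{(t;t)_\infty} \sum_{m \geq 0} e^{-\chi t^{x-m}} \frac{(-1)^m t^{\binom{m}{2}}}{(t;t)_m}, \qquad x \in \mathbb{Z}$$ (these numbers are known to be nonnegative and to sum to $1$). For two random variables $X_1, X_2$ valued in a countable discrete set $S$, $D_\infty(X_1,X_2) := \sup_{x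 \in S} |\Pr(X_1 = x) - \Pr(X_2 = x)|$; here $S = \mathbb{Z}$. *)

theory Defs
  imports
    "HOL-Probability.Probability"
    "HOL-Real_Asymp.Real_Asymp"
    "Jordan_Normal_Form.DL_Rank"
    "Berlekamp_Zassenhaus.Finite_Field"
begin

definition corank :: "'a :: field mat \<Rightarrow> nat" where
  "corank A = dim_row A - vec_space.rank (dim_row A) A"

text \<open>The product $A_k \cdots A_2 A_1$ of $N \times N$ matrices: each new factor multiplies
  from the left, and \<open>A 0\<close> is not used.\<close>

primrec left_prod :: "nat \<Rightarrow> (nat \<Rightarrow> 'a :: semiring_1 mat) \<Rightarrow> nat \<Rightarrow> 'a mat" where
  "left_prod N A 0 = 1\<^sub>m N"
| "left_prod N A (Suc k) = A (Suc k) * left_prod N A k"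

text \<open>The distance $D_\infty(X, Y)$ of two discrete random variables with values in the same
  countable type, which may live on different probability spaces.\<close>

definition D_inf :: "'a measure \<Rightarrow> ('a \<Rightarrow> 's) \<Rightarrow> 'b measure \<Rightarrow> ('b \<Rightarrow> 's) \<Rightarrow> real" where
  "D_inf M X M' Y =
     (SUP x. \<bar>measure M {\<omega> \<in> space M. X \<omega> = x} - measure M' {\<omega> \<in> space M'. Y \<omega> = x}\<bar>)"

text \<open>The $q$-Pochhammer symbol $(a;t)_n$ for finite $n$ and for $n = \infty$.\<close>

definition qpoch :: "real \<Rightarrow> real \<Rightarrow> nat \<Rightarrow> real" where
  "qpoch a t n = (\<Prod>i=1..n. 1 - a * t ^ (i - 1))"

definition qpoch_inf :: "real \<Rightarrow> real \<Rightarrow> real" where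
  "qpoch_inf a t = prodinf (\<lambda>i. 1 - a * t ^ i)"

definition L1_mass :: "real \<Rightarrow> real \<Rightarrow> int \<Rightarrow> real" where
  "L1_mass t chi x = 1 / qpoch_inf t t *
     (\<Sum>m. exp (- chi * t powi (x - int m)) * ((-1) ^ m * t ^ (m choose 2) / qpoch t t m))"

text \<open>The law of $\mathcal{L}^{(1)}_{t,\chi}$. For $0 < t < 1$ and $\chi > 0$ the masses
  \<^const>\<open>L1_mass\<close> are nonnegative and sum to 1, so that \<open>embed_pmf\<close> is meaningful; this is
  proved at the end of the theory (\<open>pmf_L1_pmf\<close>).\<close>

definition L1_pmf :: "real \<Rightarrow> real \<Rightarrow> int pmf" where
  "L1_pmf t chi = embed_pmf (L1_mass t chi)"

text \<open>Nonnegativity of the masses. Writing $y = \chi t^x$, the defining series is the infinite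
  composition of the operators $F(y) \mapsto F(y) - t^i F(y/t)$ applied to $e^{-y}$. The $k$-fold
  composition equals $y^k$ times an iterated $q$-difference quotient, and such quotients preserve
  the limits of positive combinations of decaying exponentials.\<close>

inductive cmono :: "(real \<Rightarrow> real) \<Rightarrow> bool" where
  cm_exp: "u > 0 \<Longrightarrow> cmono (\<lambda>y. exp (- u * y))"
| cm_add: "cmono f \<Longrightarrow> cmono g \<Longrightarrow> cmono (\<lambda>y. f y + g y)"
| cm_scale: "c \<ge> 0 \<Longrightarrow> cmono f \<Longrightarrow> cmono (\<lambda>y. c * f y)"
| cm_lim: "(\<And>n::nat. cmono (F n)) \<Longrightarrow> (\<And>y. y > 0 \<Longrightarrow> (\<lambda>n. F n y) \<longlonglongrightarrow> G y) \<Longrightarrow> cmono G"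

lemma cmono_nonneg: "cmono f \<Longrightarrow> y > 0 \<Longrightarrow> f y \<ge> 0"
proof (induction rule: cmono.induct)
  case (cm_lim F G)
  then show ?case by (intro LIMSEQ_le_const[of "\<lambda>n. F n y" "G y" 0]) auto
qed auto

lemma cmono_sum:
  assumes "\<And>i. cmono (F i)" shows "cmono (\<lambda>y. \<Sum>i<(n::nat). F i y)"
proof (induction n)
  case 0
  have "cmono (\<lambda>y. 0 * exp (- 1 * y))" by (intro cm_scale cm_exp) auto
  then show ?case by simp
next
  case (Suc n)
  then show ?case using cm_add[OF Suc assms[of n]] by simp
qed

lemma cmono_diff_exp:
  assumes "0 < a" "a < b"
  shows "cmono (\<lambda>y. (exp (- a * y) - exp (- b * y)) / y)"
proof (rule cm_lim)
  fix n :: nat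
  define d where "d = (b - a) / real (Suc n)"
  have d: "d > 0" using assms by (simp add: d_def)
  show "cmono (\<lambda>y. \<Sum>i<Suc n. (b - a) / real (Suc n) * exp (- (a + real i * ((b - a) / real (Suc n))) * y))"
    unfolding d_def[symmetric]
    by (intro cmono_sum cm_scale cm_exp add_pos_nonneg) (use d assms in auto)
next
  fix y :: real assume y: "y > 0"
  define c where "c = b - a"
  have c: "c > 0" using assms by (simp add: c_def)
  have eq: "(\<Sum>i<Suc n. c / real (Suc n) * exp (- (a + real i * (c / real (Suc n))) * y))
     = exp (- a * y) * (1 - exp (- c * y)) * ((c / real (Suc n)) / (1 - exp (- (c / real (Suc n)) * y)))" for n :: nat
  proof -
    define d where "d = c / real (Suc n)"
    define r where "r = exp (- d * y)"
    have "d > 0" using c by (simp add: d_def)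
    then have r1: "r \<noteq> 1" using y by (simp add: r_def)
    have rp: "r ^ i = exp (- (real i * d) * y)" for i
      by (simp add: r_def exp_of_nat_mult[symmetric] mult_ac)
    have "r ^ Suc n = exp (- c * y)" unfolding rp d_def by simp
    have "(\<Sum>i<Suc n. d * exp (- (a + real i * d) * y)) = (\<Sum>i<Suc n. d * exp (- a * y) * r ^ i)"
      by (rule sum.cong) (auto simp: rp mult_exp_exp[symmetric] algebra_simps simp flip: exp_add)
    also have "\<dots> = d * exp (- a * y) * (\<Sum>i<Suc n. r ^ i)" by (rule sum_distrib_left[symmetric])
    also have "(\<Sum>i<Suc n. r ^ i) = (1 - r ^ Suc n) / (1 - r)"
      using r1 sum_gp_strict[of r "Suc n"] by simp
    finally show ?thesis
      unfolding d_def[symmetric] \<open>r ^ Suc n = exp (- c * y)\<close> by (simp add: r_def)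
  qed
  have "((\<lambda>x. x / (1 - exp (- x * y))) \<longlongrightarrow> 1 / y) (at_right 0)"
    using y by (real_asymp simp: field_simps)
  moreover have "filterlim (\<lambda>n::nat. c / real (Suc n)) (at_right 0) sequentially"
    using c by real_asymp
  ultimately have lim: "(\<lambda>n::nat. (c / real (Suc n)) / (1 - exp (- (c / real (Suc n)) * y))) \<longlonglongrightarrow> 1 / y"
    by (rule filterlim_compose)
  have "(\<lambda>n. \<Sum>i<Suc n. c / real (Suc n) * exp (- (a + real i * (c / real (Suc n))) * y))
     \<longlonglongrightarrow> exp (- a * y) * (1 - exp (- c * y)) * (1 / y)"
    unfolding eq by (intro tendsto_mult tendsto_const lim)
  also have "exp (- a * y) * (1 - exp (- c * y)) * (1 / y) = (exp (- a * y) - exp (- b * y)) / y"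
    by (simp add: c_def algebra_simps diff_divide_distrib flip: exp_add)
  finally show "(\<lambda>n. \<Sum>i<Suc n. (b - a) / real (Suc n) * exp (- (a + real i * ((b - a) / real (Suc n))) * y))
     \<longlonglongrightarrow> (exp (- a * y) - exp (- b * y)) / y"
    by (simp only: c_def)
qed

lemma cmono_diff:
  assumes "cmono f" "0 < t" "t < 1"
  shows "cmono (\<lambda>y. (f y - f (y / t)) / y)"
  using assms(1)
proof (induction rule: cmono.induct)
  case (cm_exp u)
  then have "cmono (\<lambda>y. (exp (- u * y) - exp (- (u / t) * y)) / y)"
    using assms by (intro cmono_diff_exp) (auto simp: field_simps)
  then show ?case by simp
next
  case (cm_add f g)
  from cmono.cm_add[OF cm_add.IH] show ?case
    by (simp add: add_divide_distrib diff_divide_distrib algebra_simps)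
next
  case (cm_scale c f)
  from cmono.cm_scale[OF cm_scale(1) cm_scale.IH] show ?case
    by (simp add: diff_divide_distrib algebra_simps)
next
  case (cm_lim F G)
  show ?case
    by (rule cmono.cm_lim[OF cm_lim.IH]) (use assms in \<open>auto intro!: tendsto_intros cm_lim\<close>)
qed

primrec qdiff :: "real \<Rightarrow> (real \<Rightarrow> real) \<Rightarrow> nat \<Rightarrow> real \<Rightarrow> real" where
  "qdiff t F 0 y = F y"
| "qdiff t F (Suc k) y = qdiff t F k y - t ^ k * qdiff t F k (y / t)"

lemma qdiff_add: "qdiff t (\<lambda>y. F y + G y) k y = qdiff t F k y + qdiff t G k y"
  by (induction k arbitrary: y) (auto simp: algebra_simps)

lemma qdiff_shift: "qdiff t (\<lambda>y. F y - c * F (y / t)) k y = qdiff t F k y - c * qdiff t F k (y / t)"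
proof (induction k arbitrary: y)
  case (Suc k)
  show ?case by (simp add: Suc) (simp add: algebra_simps)
qed simp

lemma qdiff_cong:
  assumes "0 < t" "\<And>y. y > 0 \<Longrightarrow> F y = G y" "y > 0"
  shows "qdiff t F k y = qdiff t G k y"
  using assms(3)
proof (induction k arbitrary: y)
  case (Suc k)
  have "y / t > 0" using Suc.prems assms(1) by simp
  then show ?case using Suc.IH[of "y / t"] Suc.IH[of y] Suc.prems by simp
qed (simp add: assms(2))

lemma qdiff_exp_nonneg:
  assumes "0 < t" "t < 1" "y > 0"
  shows "qdiff t (\<lambda>y. exp (- y)) k y \<ge> 0"
proof -
  have "\<exists>D. cmono D \<and> (\<forall>y>0. qdiff t (\<lambda>y. exp (- y)) k y = y ^ k * D y)"
  proof (induction k)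
    case 0
    show ?case using cm_exp[of 1] by (intro exI[of _ "\<lambda>y. exp (- y)"]) auto
  next
    case (Suc k)
    then obtain D where D: "cmono D" "\<And>y. y > 0 \<Longrightarrow> qdiff t (\<lambda>y. exp (- y)) k y = y ^ k * D y"
      by blast
    show ?case
      by (intro exI[of _ "\<lambda>y. (D y - D (y / t)) / y"] conjI cmono_diff D assms)
         (use assms D in \<open>auto simp: field_simps\<close>)
  qed
  then show ?thesis using cmono_nonneg assms by (metis zero_le_mult_iff zero_le_power less_imp_le)
qed

lemma qdiff_bound:
  assumes "0 < t" "t < 1" "\<And>y. y > 0 \<Longrightarrow> \<bar>F y\<bar> \<le> B" "y > 0"
  shows "\<bar>qdiff t F k y\<bar> \<le> B * exp (1 / (1 - t))"
proof -
  have B: "B \<ge> 0" using assms(3)[of 1] by auto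
  have "\<bar>qdiff t F k y\<bar> \<le> B * exp (\<Sum>i<k. t ^ i)"
    using assms(4)
  proof (induction k arbitrary: y)
    case (Suc k)
    have "\<bar>qdiff t F (Suc k) y\<bar> \<le> \<bar>qdiff t F k y\<bar> + t ^ k * \<bar>qdiff t F k (y / t)\<bar>"
      using assms(1) abs_triangle_ineq4[of "qdiff t F k y" "t ^ k * qdiff t F k (y / t)"]
      by (simp add: abs_mult)
    also have "\<dots> \<le> B * exp (\<Sum>i<k. t ^ i) + t ^ k * (B * exp (\<Sum>i<k. t ^ i))"
      using Suc assms(1) by (intro add_mono mult_left_mono) auto
    also have "\<dots> = B * exp (\<Sum>i<k. t ^ i) * (1 + t ^ k)" by (simp add: algebra_simps)
    also have "\<dots> \<le> B * exp (\<Sum>i<k. t ^ i) * exp (t ^ k)"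
      using B by (intro mult_left_mono exp_ge_add_one_self) auto
    finally show ?case by (simp add: exp_add)
  qed (use assms in auto)
  also have "(\<Sum>i<k. t ^ i) \<le> 1 / (1 - t)"
    using assms sum_gp_strict[of t k] by (simp add: divide_right_mono)
  then have "B * exp (\<Sum>i<k. t ^ i) \<le> B * exp (1 / (1 - t))"
    using B by (intro mult_left_mono) auto
  finally show ?thesis .
qed

context
  fixes t :: real
  assumes t: "0 < t" "t < 1"
begin

private definition c :: "nat \<Rightarrow> real" where
  "c m = (-1) ^ m * t ^ (m choose 2) / qpoch t t m"

private definition S :: "(real \<Rightarrow> real) \<Rightarrow> nat \<Rightarrow> real \<Rightarrow> real" where
  "S f j y = (\<Sum>m. c m * t ^ (j * m) * f (y / t ^ m))"

private lemma qpoch_Suc: "qpoch t t (Suc m) = qpoch t t m * (1 - t ^ Suc m)"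
  by (simp add: qpoch_def)

private lemma pow_Suc_lt: "t ^ Suc m < 1"
  using t by (intro power_Suc_less_one) auto

private lemma qpoch_pos: "qpoch t t m > 0"
proof (induction m)
  case 0
  show ?case by (simp add: qpoch_def)
next
  case (Suc m)
  then show ?case unfolding qpoch_Suc using pow_Suc_lt[of m] by (intro mult_pos_pos) linarith+
qed

private lemma c_0: "c 0 = 1"
  by (simp add: c_def qpoch_def numeral_2_eq_2)

private lemma c_rec: "c (Suc m) * (1 - t ^ Suc m) = - (t ^ m * c m)"
proof -
  have "Suc m choose 2 = m + (m choose 2)" by (simp add: numeral_2_eq_2)
  then have "c (Suc m) = - (t ^ m * c m) / (1 - t ^ Suc m)"
    unfolding c_def qpoch_Suc using qpoch_pos[of m] pow_Suc_lt[of m]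
    by (simp add: power_add divide_simps)
  then show ?thesis using pow_Suc_lt[of m] by (simp del: power_Suc)
qed

private lemma summable_c: "summable (\<lambda>m. \<bar>c m\<bar>)"
proof -
  have "(\<lambda>m. t ^ m / (1 - t)) \<longlonglongrightarrow> 0 / (1 - t)"
    using t by (intro tendsto_divide LIMSEQ_realpow_zero) auto
  then have "\<forall>\<^sub>F m in sequentially. t ^ m / (1 - t) < 1 / 2"
    by (intro order_tendstoD) auto
  then obtain N where N: "\<And>m. m \<ge> N \<Longrightarrow> t ^ m / (1 - t) < 1 / 2"
    by (auto simp: eventually_sequentially)
  show ?thesis
  proof (rule summable_ratio_test[of "1/2" N])
    fix m assume "m \<ge> N"
    have le: "1 - t \<le> 1 - t ^ Suc m" using t power_decreasing[of 1 "Suc m" t] by simp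
    have "\<bar>c (Suc m)\<bar> * (1 - t) \<le> \<bar>c (Suc m)\<bar> * (1 - t ^ Suc m)"
      using le by (intro mult_left_mono) auto
    also have "\<dots> = \<bar>c (Suc m) * (1 - t ^ Suc m)\<bar>" using le t by (subst abs_mult) (subst (3) abs_of_nonneg, linarith+)
    also have "\<dots> = t ^ m * \<bar>c m\<bar>" unfolding c_rec using t by (simp add: abs_mult)
    finally have "\<bar>c (Suc m)\<bar> \<le> t ^ m / (1 - t) * \<bar>c m\<bar>" using t by (simp add: field_simps)
    also have "\<dots> \<le> 1 / 2 * \<bar>c m\<bar>" using N[OF \<open>m \<ge> N\<close>] by (intro mult_right_mono) auto
    finally show "norm \<bar>c (Suc m)\<bar> \<le> 1 / 2 * norm \<bar>c m\<bar>" by simp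
  qed simp
qed

private lemma bound_term:
  assumes "\<And>y. y > 0 \<Longrightarrow> \<bar>f y\<bar> \<le> 1" "y > 0"
  shows "\<bar>c m * t ^ (j * m) * f (y / t ^ m)\<bar> \<le> \<bar>c m\<bar>"
proof -
  have "\<bar>t ^ (j * m)\<bar> \<le> 1" "\<bar>f (y / t ^ m)\<bar> \<le> 1" using t assms by (auto simp: power_le_one)
  then have "\<bar>t ^ (j * m)\<bar> * \<bar>f (y / t ^ m)\<bar> \<le> 1" by (intro mult_le_one) auto
  then show ?thesis
    by (simp add: abs_mult mult.assoc mult_left_le)
qed

private lemma S_summable:
  assumes "\<And>y. y > 0 \<Longrightarrow> \<bar>f y\<bar> \<le> 1" "y > 0"
  shows "summable (\<lambda>m. c m * t ^ (j * m) * f (y / t ^ m))"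
  by (rule summable_comparison_test'[OF summable_c]) (use bound_term[OF assms] in auto)

private lemma S_rec:
  assumes "\<And>y. y > 0 \<Longrightarrow> \<bar>f y\<bar> \<le> 1" "y > 0"
  shows "S f j y = S f (Suc j) y - t ^ j * S f (Suc j) (y / t)"
proof -
  have y': "y / t > 0" using t assms by simp
  let ?a = "\<lambda>m. c m * t ^ (j * m) * f (y / t ^ m)"
  let ?b = "\<lambda>m. c m * t ^ (Suc j * m) * f (y / t ^ m)"
  have s: "summable (\<lambda>m. ?a m - ?b m)"
    by (intro summable_diff S_summable[OF assms])
  have "S f j y - S f (Suc j) y = (\<Sum>m. ?a m - ?b m)"
    unfolding S_def by (intro suminf_diff S_summable[OF assms])
  also have "\<dots> = (\<Sum>m. ?a (Suc m) - ?b (Suc m)) + (?a 0 - ?b 0)"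
    using suminf_split_head[OF s] by simp
  also have "(\<lambda>m. ?a (Suc m) - ?b (Suc m)) = (\<lambda>m. - (t ^ j) * (c m * t ^ (Suc j * m) * f (y / t / t ^ m)))"
  proof
    fix m
    have "?a (Suc m) - ?b (Suc m) = c (Suc m) * (1 - t ^ Suc m) * t ^ (j * Suc m) * f (y / t ^ Suc m)"
      by (simp add: algebra_simps power_add)
    then show "?a (Suc m) - ?b (Suc m) = - (t ^ j) * (c m * t ^ (Suc j * m) * f (y / t / t ^ m))"
      unfolding c_rec by (simp add: algebra_simps power_add)
  qed
  also have "(\<Sum>m. - (t ^ j) * (c m * t ^ (Suc j * m) * f (y / t / t ^ m))) = - (t ^ j) * S f (Suc j) (y / t)"
    unfolding S_def by (intro suminf_mult S_summable[OF assms(1) y'])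
  finally show ?thesis by simp
qed

private lemma S_limit:
  assumes "\<And>y. y > 0 \<Longrightarrow> \<bar>f y\<bar> \<le> 1" "y > 0"
  shows "\<bar>S f j y - f y\<bar> \<le> t ^ j * (\<Sum>m. \<bar>c (Suc m)\<bar>)"
proof -
  let ?a = "\<lambda>m. c m * t ^ (j * m) * f (y / t ^ m)"
  have s: "summable ?a" by (rule S_summable[OF assms])
  have c': "summable (\<lambda>m. t ^ j * \<bar>c (Suc m)\<bar>)"
    using summable_c by (intro summable_mult) (subst summable_Suc_iff)
  have b: "\<bar>?a (Suc m)\<bar> \<le> t ^ j * \<bar>c (Suc m)\<bar>" for m
  proof -
    have "\<bar>c (Suc m) * t ^ (j * m) * f (y / t ^ Suc m)\<bar> \<le> \<bar>c (Suc m)\<bar>"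
    proof -
      have "\<bar>t ^ (j * m)\<bar> \<le> 1" "\<bar>f (y / t ^ Suc m)\<bar> \<le> 1" using t assms(2)
        by (auto simp: power_le_one simp del: power_Suc intro!: assms(1))
      then have "\<bar>t ^ (j * m)\<bar> * \<bar>f (y / t ^ Suc m)\<bar> \<le> 1" by (intro mult_le_one) auto
      then show ?thesis
        by (simp add: abs_mult mult.assoc mult_left_le del: power_Suc)
    qed
    then have "t ^ j * \<bar>c (Suc m) * t ^ (j * m) * f (y / t ^ Suc m)\<bar> \<le> t ^ j * \<bar>c (Suc m)\<bar>"
      using t by (intro mult_left_mono) auto
    then show ?thesis using t by (simp add: abs_mult power_add mult_ac)
  qed
  have "S f j y - f y = (\<Sum>m. ?a (Suc m))"
    unfolding S_def using suminf_split_head[OF s] by (simp add: c_0)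
  also have "\<bar>\<dots>\<bar> \<le> (\<Sum>m. t ^ j * \<bar>c (Suc m)\<bar>)"
    using norm_suminf_le[OF _ c', of "\<lambda>m. ?a (Suc m)"] b by simp
  also have "\<dots> = t ^ j * (\<Sum>m. \<bar>c (Suc m)\<bar>)"
    using summable_c by (intro suminf_mult) (subst summable_Suc_iff)
  finally show ?thesis .
qed

private lemma S_tendsto:
  assumes "\<And>y. y > 0 \<Longrightarrow> \<bar>f y\<bar> \<le> 1" "y > 0"
  shows "(\<lambda>j. S f j y) \<longlonglongrightarrow> f y"
proof -
  have "(\<lambda>j. t ^ j * (\<Sum>m. \<bar>c (Suc m)\<bar>)) \<longlonglongrightarrow> 0 * (\<Sum>m. \<bar>c (Suc m)\<bar>)"
    using t by (intro tendsto_mult LIMSEQ_realpow_zero tendsto_const) auto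
  then have "(\<lambda>j. S f j y - f y) \<longlonglongrightarrow> 0"
    by (intro Lim_null_comparison[of "\<lambda>j. S f j y - f y"]) (use S_limit[of f y, OF assms] in \<open>auto intro!: always_eventually\<close>)
  then show ?thesis by (simp add: LIM_zero_iff)
qed

private lemma S_qdiff:
  assumes "\<And>y. y > 0 \<Longrightarrow> \<bar>f y\<bar> \<le> 1" "y > 0"
  shows "S f 0 y = qdiff t (S f k) k y"
proof (induction k)
  case (Suc k)
  have "qdiff t (S f k) k y = qdiff t (\<lambda>y. S f (Suc k) y - t ^ k * S f (Suc k) (y / t)) k y"
    by (rule qdiff_cong[OF t(1) _ assms(2)]) (rule S_rec[where f = f, OF assms(1)])
  then show ?case using Suc by (simp add: qdiff_shift)
qed simp

private abbreviation "E \<equiv> (\<lambda>y::real. exp (- y))"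

private lemma E_le: "y > 0 \<Longrightarrow> \<bar>E y\<bar> \<le> 1"
  by simp

private lemma S_nonneg:
  assumes "y > 0"
  shows "S E 0 y \<ge> 0"
proof -
  define K where "K = (\<Sum>m. \<bar>c (Suc m)\<bar>)"
  have ge: "S E 0 y \<ge> - (t ^ k * K * exp (1 / (1 - t)))" for k
  proof -
    have "S E 0 y = qdiff t (\<lambda>y. E y + (S E k y - E y)) k y"
      using S_qdiff[OF E_le assms] by simp
    also have "\<dots> = qdiff t E k y + qdiff t (\<lambda>y. S E k y - E y) k y"
      by (rule qdiff_add)
    finally have "S E 0 y = qdiff t E k y + qdiff t (\<lambda>y. S E k y - E y) k y" .
    moreover have "\<bar>qdiff t (\<lambda>y. S E k y - E y) k y\<bar> \<le> t ^ k * K * exp (1 / (1 - t))"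
      unfolding K_def by (intro qdiff_bound t S_limit assms E_le)
    ultimately show ?thesis using qdiff_exp_nonneg[OF t assms, of k] by linarith
  qed
  have "(\<lambda>k. - (t ^ k * K * exp (1 / (1 - t)))) \<longlonglongrightarrow> - (0 * K * exp (1 / (1 - t)))"
    using t by (intro tendsto_intros LIMSEQ_realpow_zero) auto
  then show ?thesis using ge by (intro LIMSEQ_le_const2) auto
qed

private lemma S_const: "S (\<lambda>_. 1) 1 1 = qpoch_inf t t"
proof -
  let ?s = "\<lambda>j. S (\<lambda>_. 1) j 1"
  have r: "?s j = (1 - t ^ j) * ?s (Suc j)" for j
  proof -
    have "S (\<lambda>_. 1) (Suc j) (1 / t) = ?s (Suc j)" by (simp add: S_def)
    then show ?thesis using S_rec[of "\<lambda>_. 1" 1 j] by (simp add: algebra_simps)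
  qed
  have p: "?s 1 = (\<Prod>i<n. 1 - t * t ^ i) * ?s (Suc n)" for n
  proof (induction n)
    case (Suc n)
    then show ?case by (subst (asm) r[of "Suc n"]) (simp add: mult.assoc)
  qed simp
  have "convergent_prod (\<lambda>i. 1 - t * t ^ i)"
    by (intro abs_convergent_prod_imp_convergent_prod summable_imp_abs_convergent_prod)
       (use t in \<open>auto simp: abs_mult intro!: summable_mult summable_geometric\<close>)
  then have "(\<lambda>n. \<Prod>i<n. 1 - t * t ^ i) \<longlonglongrightarrow> qpoch_inf t t"
    unfolding qpoch_inf_def using convergent_prod_LIMSEQ LIMSEQ_lessThan_iff_atMost by blast
  moreover have "(\<lambda>n. ?s (Suc n)) \<longlonglongrightarrow> 1"
    using S_tendsto[of "\<lambda>_. 1" 1] by (intro LIMSEQ_Suc) auto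
  ultimately have "(\<lambda>n. (\<Prod>i<n. 1 - t * t ^ i) * ?s (Suc n)) \<longlonglongrightarrow> qpoch_inf t t * 1"
    by (rule tendsto_mult)
  then show ?thesis unfolding p[symmetric] by (simp add: LIMSEQ_const_iff)
qed

private lemma qpoch_inf_pos: "qpoch_inf t t > 0"
  unfolding qpoch_inf_def
proof -
  have cp: "convergent_prod (\<lambda>i. 1 - t * t ^ i)"
    by (intro abs_convergent_prod_imp_convergent_prod summable_imp_abs_convergent_prod)
       (use t in \<open>auto simp: abs_mult intro!: summable_mult summable_geometric\<close>)
  have pos: "0 < 1 - t * t ^ i" for i using pow_Suc_lt[of i] by simp
  have "prodinf (\<lambda>i. 1 - t * t ^ i) \<noteq> 0"
    using pos by (intro prodinf_nonzero cp) (metis less_irrefl)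
  moreover have "prodinf (\<lambda>i. 1 - t * t ^ i) \<ge> 0"
    by (rule LIMSEQ_le_const[OF convergent_prod_LIMSEQ[OF cp]]) (use pos in \<open>auto intro!: exI[of _ 0] prod_nonneg simp: less_imp_le\<close>)
  ultimately show "prodinf (\<lambda>i. 1 - t * t ^ i) > 0" by simp
qed

private lemma L1_mass_S:
  "L1_mass t chi x = S E 0 (chi * t powi x) / qpoch_inf t t"
proof -
  have "exp (- chi * t powi (x - int m)) = E (chi * t powi x / t ^ m)" for m
    using t by (simp add: power_int_diff)
  then show ?thesis by (simp add: L1_mass_def S_def c_def mult_ac)
qed

private lemma S_lim:
  assumes "\<And>n. Y n > 0" "\<And>m. (\<lambda>n. E (Y n / t ^ m)) \<longlonglongrightarrow> l"
  shows "(\<lambda>n. S E 1 (Y n)) \<longlonglongrightarrow> (\<Sum>m. c m * t ^ (1 * m) * l)"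
  unfolding S_def
proof (rule tannerys_theorem[THEN conjunct2, THEN conjunct2])
  show "(\<lambda>n. c m * t ^ (1 * m) * E (Y n / t ^ m)) \<longlonglongrightarrow> c m * t ^ (1 * m) * l" for m
    by (intro tendsto_mult tendsto_const assms)
  show "\<forall>\<^sub>F (m, n) in at_top \<times>\<^sub>F sequentially. norm (c m * t ^ (1 * m) * E (Y n / t ^ m)) \<le> \<bar>c m\<bar>"
    using bound_term[where f = E and j = 1, OF E_le assms(1)] by (intro always_eventually) auto
qed (use summable_c in auto)

lemma L1_mass_nonneg: "chi > 0 \<Longrightarrow> L1_mass t chi x \<ge> 0"
  unfolding L1_mass_S using t qpoch_inf_pos S_nonneg[of "chi * t powi x"] by simp

lemma nn_integral_L1_mass:
  assumes "chi > 0"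
  shows "(\<integral>\<^sup>+ x. ennreal (L1_mass t chi x) \<partial>count_space UNIV) = 1"
proof -
  let ?L = "L1_mass t chi"
  define g where "g x = S E 1 (chi * t powi x)" for x
  have pos: "chi * t powi x > 0" for x using t assms by simp
  have L: "?L x = (g x - g (x - 1)) / qpoch_inf t t" for x
  proof -
    have "chi * t powi (x - 1) = chi * t powi x / t" using t by (simp add: power_int_diff)
    then show ?thesis
      using S_rec[where f = E and j = 0, OF E_le pos, of x] by (simp add: L1_mass_S g_def)
  qed
  have sum: "(\<Sum>x\<in>{- int n..int n}. ?L x) = (g (int n) - g (- int n - 1)) / qpoch_inf t t" for n
  proof (induction n)
    case 0
    show ?case by (simp add: L)
  next
    case (Suc n)
    have "{- int (Suc n)..int (Suc n)} = insert (int (Suc n)) (insert (- int (Suc n)) {- int n..int n})"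
      by auto
    then have "(\<Sum>x\<in>{- int (Suc n)..int (Suc n)}. ?L x)
      = ?L (int (Suc n)) + (?L (- int (Suc n)) + (\<Sum>x\<in>{- int n..int n}. ?L x))"
      by simp
    moreover have e: "int (Suc n) - 1 = int n" "- int (Suc n) = - int n - 1" by auto
    have "?L (int (Suc n)) + (?L (- int (Suc n)) + (\<Sum>x\<in>{- int n..int n}. ?L x)) = (g (int (Suc n)) - g (- int (Suc n) - 1)) / qpoch_inf t t"
      unfolding Suc unfolding L e by (simp only: diff_divide_distrib)
    ultimately show ?case by simp
  qed
  have "(\<lambda>n. g (int n)) \<longlonglongrightarrow> (\<Sum>m. c m * t ^ (1 * m) * 1)"
    unfolding g_def
  proof (rule S_lim[OF pos])
    fix m
    have "(\<lambda>n. exp (- (chi * t ^ n / t ^ m))) \<longlonglongrightarrow> exp (- (chi * 0 / t ^ m))"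
      using t by (intro tendsto_intros LIMSEQ_realpow_zero) auto
    then show "(\<lambda>n. E (chi * t powi int n / t ^ m)) \<longlonglongrightarrow> 1" by simp
  qed
  also have "(\<Sum>m. c m * t ^ (1 * m) * 1) = qpoch_inf t t"
    using S_const by (simp add: S_def)
  finally have g1: "(\<lambda>n. g (int n)) \<longlonglongrightarrow> qpoch_inf t t" .
  have "(\<lambda>n. g (- int n - 1)) \<longlonglongrightarrow> (\<Sum>m. c m * t ^ (1 * m) * 0)"
    unfolding g_def
  proof (rule S_lim[OF pos])
    fix m
    have "filterlim (\<lambda>n::nat. inverse t ^ n) at_top sequentially"
      using t by (intro filterlim_at_infinity_imp_filterlim_at_top filterlim_realpow_sequentially_gt1)
               (auto simp: one_less_inverse)
    then have "filterlim (\<lambda>n. (chi * inverse t / t ^ m) * inverse t ^ n) at_top sequentially"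
      using t assms by (intro filterlim_tendsto_pos_mult_at_top[OF tendsto_const]) auto
    also have "(\<lambda>n. (chi * inverse t / t ^ m) * inverse t ^ n) = (\<lambda>n. chi * t powi (- int n - 1) / t ^ m)"
      using t by (simp add: power_int_diff power_int_minus field_simps)
    finally show "(\<lambda>n. E (chi * t powi (- int n - 1) / t ^ m)) \<longlonglongrightarrow> 0"
      by (intro filterlim_compose[OF exp_at_bot] filterlim_compose[OF filterlim_uminus_at_bot_at_top])
  qed
  then have g2: "(\<lambda>n. g (- int n - 1)) \<longlonglongrightarrow> 0" by simp
  have "(\<lambda>n. (g (int n) - g (- int n - 1)) / qpoch_inf t t) \<longlonglongrightarrow> (qpoch_inf t t - 0) / qpoch_inf t t"
    using qpoch_inf_pos by (intro tendsto_intros g1 g2) auto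
  then have lim: "(\<lambda>n. \<Sum>x\<in>{- int n..int n}. ?L x) \<longlonglongrightarrow> 1"
    unfolding sum using qpoch_inf_pos by simp
  let ?F = "\<lambda>n x. ennreal (?L x) * indicator {- int n..int n} x"
  have "(\<lambda>n. \<integral>\<^sup>+ x. ?F n x \<partial>count_space UNIV) \<longlonglongrightarrow> (\<integral>\<^sup>+ x. ennreal (?L x) \<partial>count_space UNIV)"
  proof (rule nn_integral_LIMSEQ)
    show "incseq ?F"
      by (auto simp: incseq_def le_fun_def indicator_def)
    show "(\<lambda>n. ?F n x) \<longlonglongrightarrow> ennreal (?L x)" for x
    proof (rule tendsto_eventually)
      show "\<forall>\<^sub>F n in sequentially. ?F n x = ennreal (?L x)"
        by (intro eventually_sequentiallyI[of "nat \<bar>x\<bar>"]) (auto simp: indicator_def)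
    qed
  qed auto
  moreover have "(\<integral>\<^sup>+ x. ?F n x \<partial>count_space UNIV) = ennreal (\<Sum>x\<in>{- int n..int n}. ?L x)" for n
    using L1_mass_nonneg[OF assms]
    by (simp add: nn_integral_count_space_indicator[symmetric] nn_integral_count_space_finite sum_ennreal)
  moreover have "(\<lambda>n. ennreal (\<Sum>x\<in>{- int n..int n}. ?L x)) \<longlonglongrightarrow> ennreal 1"
    using lim by (intro tendsto_ennrealI)
  ultimately have "(\<lambda>n. ennreal (\<Sum>x\<in>{- int n..int n}. ?L x)) \<longlonglongrightarrow> (\<integral>\<^sup>+ x. ennreal (?L x) \<partial>count_space UNIV)"
    and "(\<lambda>n. ennreal (\<Sum>x\<in>{- int n..int n}. ?L x)) \<longlonglongrightarrow> ennreal 1"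
    by simp_all
  then show ?thesis using LIMSEQ_unique ennreal_1 by metis
qed

end

lemma pmf_L1_pmf:
  assumes "0 < t" "t < 1" "chi > 0"
  shows "pmf (L1_pmf t chi) x = L1_mass t chi x"
  unfolding L1_pmf_def
  by (intro pmf_embed_pmf L1_mass_nonneg nn_integral_L1_mass assms)

end

theory Submission
  imports Defs
begin

text \<open>Write \<open>t = 1 / p\<close>. For a product \<open>B\<close> of \<open>s\<close> independent uniform $N \times N$ matrices and a
  linearly independent \<open>j\<close>-tuple \<open>us\<close>, the tuple \<open>B us\<close> stays independent with probability exactly
  \<open>\<phi>\<^sub>j(N) ^ s\<close>, where \<open>\<phi>\<^sub>j(r) = (t;t)\<^sub>r / (t;t)\<^sub>r\<^sub>-\<^sub>j\<close>: one uniform matrix maps an independent tuple to a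
  uniform tuple. On the other hand a matrix of rank \<open>r\<close> keeps a proportion \<open>\<phi>\<^sub>j(r)\<close> of all \<open>j\<close>-tuples
  independent. Averaging over all tuples gives \<open>E[\<phi>\<^sub>j(rank B)] = \<phi>\<^sub>j(N) ^ (s + 1)\<close>, and \<open>q\<close>-binomial
  inversion turns these moments into
  \<open>Pr(corank B = d) = (\<Sum>m\<le>d. c\<^sub>m * ((t;t)\<^sub>N / (t;t)\<^sub>d\<^sub>-\<^sub>m) ^ (s + 1)) / (t;t)\<^sub>N\<^sub>-\<^sub>d\<close>
  with \<open>c\<^sub>m = (-1) ^ m * t ^ (m choose 2) / (t;t)\<^sub>m\<close>. The power is close to
  \<open>exp (- s * t / (1 - t) * t ^ (d - m))\<close>, so the sum is termwise the series of the limit law, and the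
  total error is $O(1/s + s t^N)$ uniformly in \<open>d\<close>.\<close>

subsection \<open>Independent tuples over a finite field\<close>

text \<open>The span of a list, built one vector at a time so that sizes and images follow by
  induction. The link to the span of the library is made inside
  \<open>card_image_mult_mat_vec\<close>.\<close>

primrec vspan :: "nat \<Rightarrow> 'a :: field vec list \<Rightarrow> 'a vec set" where
  "vspan n [] = {0\<^sub>v n}"
| "vspan n (v # vs) = {c \<cdot>\<^sub>v v + w | c w. w \<in> vspan n vs}"

text \<open>Independence in the form used for counting: each vector avoids the span of those after
  it, so tuples grow by prepending. A list with a repeated vector is dependent.\<close>

primrec indep_list :: "nat \<Rightarrow> 'a :: field vec list \<Rightarrow> bool" where
  "indep_list n [] = True"
| "indep_list n (v # vs) = (v \<notin> vspan n vs \<and> indep_list n vs)"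

definition vec_lists :: "nat \<Rightarrow> nat \<Rightarrow> 'a vec list set" where
  "vec_lists n j = {vs. set vs \<subseteq> carrier_vec n \<and> length vs = j}"

lemma vec_lists_0: "vec_lists n 0 = {[]}"
  by (auto simp: vec_lists_def)

lemma vec_lists_Suc: "vec_lists n (Suc j) = (\<lambda>(v, vs). v # vs) ` (carrier_vec n \<times> vec_lists n j)"
  by (auto simp: vec_lists_def image_iff length_Suc_conv)

lemma finite_carrier_vec [simp]: "finite (carrier_vec n :: 'a :: finite vec set)"
  and card_carrier_vec: "card (carrier_vec n :: 'a :: finite vec set) = CARD('a) ^ n"
proof -
  let ?L = "{xs :: 'a list. set xs \<subseteq> UNIV \<and> length xs = n}"
  have b: "bij_betw list_of_vec (carrier_vec n) ?L"
  proof (rule bij_betw_byWitness[where f' = vec_of_list])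
    show "list_of_vec ` carrier_vec n \<subseteq> ?L" by auto
    show "vec_of_list ` ?L \<subseteq> carrier_vec n" using dim_vec_of_list by (auto intro: carrier_vecI)
  qed (simp_all add: vec_list list_vec)
  show "finite (carrier_vec n :: 'a vec set)"
    using bij_betw_finite[OF b] finite_lists_length_eq[of "UNIV :: 'a set" n] by simp
  show "card (carrier_vec n :: 'a vec set) = CARD('a) ^ n"
    using bij_betw_same_card[OF b] card_lists_length_eq[of "UNIV :: 'a set" n] by simp
qed

lemma finite_vec_lists [simp]: "finite (vec_lists n j :: 'a :: finite vec list set)"
  unfolding vec_lists_def by (intro finite_lists_length_eq) simp

lemma card_vec_lists: "card (vec_lists n j :: 'a :: finite vec list set) = CARD('a) ^ (n * j)"
  unfolding vec_lists_def by (subst card_lists_length_eq) (simp_all add: card_carrier_vec power_mult)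

lemma map_mult_in_vec_lists:
  "A \<in> carrier_mat n m \<Longrightarrow> vs \<in> vec_lists m j \<Longrightarrow> map ((*\<^sub>v) A) vs \<in> vec_lists n j"
  by (auto simp: vec_lists_def)

lemma vspan_closed: "set vs \<subseteq> carrier_vec n \<Longrightarrow> w \<in> vspan n vs \<Longrightarrow> w \<in> carrier_vec n"
  by (induction vs arbitrary: w) auto

lemma vspan_add:
  assumes "set vs \<subseteq> carrier_vec n" "x \<in> vspan n vs" "y \<in> vspan n vs"
  shows "x + y \<in> vspan n vs"
  using assms
proof (induction vs arbitrary: x y)
  case (Cons v vs)
  then obtain c w d z where x: "x = c \<cdot>\<^sub>v v + w" "w \<in> vspan n vs" and y: "y = d \<cdot>\<^sub>v v + z" "z \<in> vspan n vs"
    by auto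
  have "w \<in> carrier_vec n" "z \<in> carrier_vec n" "v \<in> carrier_vec n"
    using vspan_closed x y Cons.prems by auto
  then have "x + y = (c + d) \<cdot>\<^sub>v v + (w + z)"
    unfolding x y by (intro eq_vecI) (auto simp: algebra_simps)
  moreover have "w + z \<in> vspan n vs" using Cons x y by auto
  ultimately show ?case by auto
qed auto

lemma vspan_smult:
  assumes "set vs \<subseteq> carrier_vec n" "x \<in> vspan n vs"
  shows "a \<cdot>\<^sub>v x \<in> vspan n vs"
  using assms
proof (induction vs arbitrary: x)
  case (Cons v vs)
  then obtain c w where x: "x = c \<cdot>\<^sub>v v + w" "w \<in> vspan n vs" by auto
  have "w \<in> carrier_vec n" "v \<in> carrier_vec n" using vspan_closed x Cons.prems by auto
  then have "a \<cdot>\<^sub>v x = (a * c) \<cdot>\<^sub>v v + a \<cdot>\<^sub>v w"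
    unfolding x by (intro eq_vecI) (auto simp: algebra_simps)
  moreover have "a \<cdot>\<^sub>v w \<in> vspan n vs" using Cons x by auto
  ultimately show ?case by auto
qed auto

text \<open>Prepending \<open>v\<close> outside the span makes the representation
  \<open>c \<cdot>\<^sub>v v + w\<close> unique, so the size is multiplied by the order of the
  field.\<close>

lemma card_vspan:
  fixes vs :: "'a :: {field, finite} vec list"
  assumes "set vs \<subseteq> carrier_vec n" "indep_list n vs"
  shows "card (vspan n vs) = CARD('a) ^ length vs"
  using assms
proof (induction vs)
  case (Cons v vs)
  have v: "v \<in> carrier_vec n" and vs: "set vs \<subseteq> carrier_vec n" and nv: "v \<notin> vspan n vs"
    using Cons.prems by auto
  let ?f = "\<lambda>(c, w). c \<cdot>\<^sub>v v + w"
  have "vspan n (v # vs) = ?f ` (UNIV \<times> vspan n vs)" by auto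
  moreover have "inj_on ?f (UNIV \<times> vspan n vs)"
  proof (rule inj_onI, clarify)
    fix c w d z assume w: "w \<in> vspan n vs" and z: "z \<in> vspan n vs" and eq: "c \<cdot>\<^sub>v v + w = d \<cdot>\<^sub>v v + z"
    have wz: "w \<in> carrier_vec n" "z \<in> carrier_vec n" using w z vspan_closed[OF vs] by auto
    have e: "c * v $ i + w $ i = d * v $ i + z $ i" if "i < n" for i
    proof -
      have "(c \<cdot>\<^sub>v v + w) $ i = (d \<cdot>\<^sub>v v + z) $ i" using eq by simp
      then show ?thesis using that v wz by simp
    qed
    have "c = d"
    proof (rule ccontr)
      assume "c \<noteq> d"
      \<comment> \<open>Solving the two representations for \<open>v\<close> would place it in the
        span of the later vectors.\<close>
      have "v = (1 / (c - d)) \<cdot>\<^sub>v (z + (- 1) \<cdot>\<^sub>v w)"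
      proof (intro eq_vecI)
        fix i assume "i < dim_vec ((1 / (c - d)) \<cdot>\<^sub>v (z + (- 1) \<cdot>\<^sub>v w))"
        then have i: "i < n" using wz by auto
        have "(c - d) * v $ i = z $ i - w $ i" using e[OF i] by (simp add: algebra_simps)
        then show "v $ i = ((1 / (c - d)) \<cdot>\<^sub>v (z + (- 1) \<cdot>\<^sub>v w)) $ i"
          using i v wz \<open>c \<noteq> d\<close> by (simp add: field_simps)
      qed (use v wz in auto)
      then have "v \<in> vspan n vs" using vspan_smult vspan_add w z vs by metis
      then show False using nv by simp
    qed
    moreover have "w = z" using e wz \<open>c = d\<close> by (intro eq_vecI) auto
    ultimately show "c = d \<and> w = z" by simp
  qed
  ultimately have "card (vspan n (v # vs)) = card ((UNIV :: 'a set) \<times> vspan n vs)"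
    by (simp add: card_image)
  then show ?case using Cons by (simp add: card_cartesian_product)
qed simp

section \<open>Matrices acting on spans: images, fibres and rank\<close>

lemma vspan_map_mult:
  assumes "A \<in> carrier_mat n m" "set vs \<subseteq> carrier_vec m"
  shows "vspan n (map ((*\<^sub>v) A) vs) = (*\<^sub>v) A ` vspan m vs"
  using assms(2)
proof (induction vs)
  case Nil
  then show ?case using assms(1) by (auto simp: scalar_prod_def intro!: eq_vecI)
next
  case (Cons v vs)
  have "A *\<^sub>v (c \<cdot>\<^sub>v v + w) = c \<cdot>\<^sub>v (A *\<^sub>v v) + A *\<^sub>v w" if "w \<in> vspan m vs" for c w
  proof -
    have "w \<in> carrier_vec m" "v \<in> carrier_vec m" using that vspan_closed Cons.prems by auto
    then show ?thesis using assms(1) by (simp add: mult_add_distrib_mat_vec mult_mat_vec)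
  qed
  then show ?case using Cons by (force simp: image_iff)
qed

text \<open>A linear relation among the vectors is carried over to their images, so dependence can
  never be undone by multiplication.\<close>

lemma indep_list_map_multD:
  assumes "A \<in> carrier_mat n m" "set vs \<subseteq> carrier_vec m" "indep_list n (map ((*\<^sub>v) A) vs)"
  shows "indep_list m vs"
  using assms(2,3)
proof (induction vs)
  case (Cons v vs)
  then show ?case using vspan_map_mult[OF assms(1), of vs] by auto
qed simp

lemma mult_mat_vec_eq_on_vspan:
  assumes "A \<in> carrier_mat n m" "B \<in> carrier_mat n m" "set vs \<subseteq> carrier_vec m"
    and "map ((*\<^sub>v) A) vs = map ((*\<^sub>v) B) vs" "x \<in> vspan m vs"
  shows "A *\<^sub>v x = B *\<^sub>v x"
  using assms(3-5)
proof (induction vs arbitrary: x)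
  case Nil
  then show ?case using assms(1,2) by (auto simp: scalar_prod_def intro!: eq_vecI)
next
  case (Cons v vs)
  then obtain c w where x: "x = c \<cdot>\<^sub>v v + w" "w \<in> vspan m vs" by auto
  have "w \<in> carrier_vec m" "v \<in> carrier_vec m" using vspan_closed x Cons.prems by auto
  moreover have "A *\<^sub>v w = B *\<^sub>v w" using Cons x by auto
  ultimately show ?case using assms(1,2) Cons.prems unfolding x
    by (simp add: mult_add_distrib_mat_vec mult_mat_vec)
qed

lemma mat_eqI_mult_vec:
  fixes A B :: "'a :: semiring_1 mat"
  assumes "A \<in> carrier_mat n m" "B \<in> carrier_mat n m" "\<And>x. x \<in> carrier_vec m \<Longrightarrow> A *\<^sub>v x = B *\<^sub>v x"
  shows "A = B"
proof (rule eq_matI)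
  fix i j assume "i < dim_row B" "j < dim_col B"
  then have ij: "i < n" "j < m" using assms by auto
  have "(A *\<^sub>v unit_vec m j) $ i = (B *\<^sub>v unit_vec m j) $ i" using assms(3) by simp
  then show "A $$ (i, j) = B $$ (i, j)" using ij assms(1,2) by simp
qed (use assms in auto)

text \<open>Each fibre over a point of the image is a translate of the kernel.\<close>

lemma card_vimage_mult_mat_vec:
  fixes P :: "'a :: {field, finite} mat"
  assumes P: "P \<in> carrier_mat n m" and S: "S \<subseteq> (*\<^sub>v) P ` carrier_vec m"
  shows "card {x \<in> carrier_vec m. P *\<^sub>v x \<in> S} = card {x \<in> carrier_vec m. P *\<^sub>v x = 0\<^sub>v n} * card S"
proof -
  let ?K = "{x \<in> carrier_vec m. P *\<^sub>v x = 0\<^sub>v n}"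
  have fib: "card {x \<in> carrier_vec m. P *\<^sub>v x = y} = card ?K" if y: "y \<in> S" for y
  proof -
    obtain x0 where x0: "x0 \<in> carrier_vec m" "y = P *\<^sub>v x0" using S y by auto
    have "bij_betw (\<lambda>x. x + x0) ?K {x \<in> carrier_vec m. P *\<^sub>v x = y}"
    proof (rule bij_betw_byWitness[where f' = "\<lambda>x. x - x0"])
      show "(\<lambda>x. x + x0) ` ?K \<subseteq> {x \<in> carrier_vec m. P *\<^sub>v x = y}"
        using P x0 by (auto simp: mult_add_distrib_mat_vec)
      show "(\<lambda>x. x - x0) ` {x \<in> carrier_vec m. P *\<^sub>v x = y} \<subseteq> ?K"
        using P x0 by (auto simp: mult_minus_distrib_mat_vec)
      show "\<forall>a\<in>?K. a + x0 - x0 = a" "\<forall>a'\<in>{x \<in> carrier_vec m. P *\<^sub>v x = y}. a' - x0 + x0 = a'"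
        using x0 by (auto intro!: eq_vecI)
    qed
    from bij_betw_same_card[OF this] show ?thesis by simp
  qed
  have fS: "finite S" using S by (rule finite_subset) simp
  have "{x \<in> carrier_vec m. P *\<^sub>v x \<in> S} = (\<Union>y\<in>S. {x \<in> carrier_vec m. P *\<^sub>v x = y})" by auto
  also have "card \<dots> = (\<Sum>y\<in>S. card {x \<in> carrier_vec m. P *\<^sub>v x = y})"
    by (intro card_UN_disjoint fS) auto
  also have "\<dots> = card ?K * card S" using fib by simp
  finally show ?thesis .
qed

text \<open>This ties the rank of the library to counting: the image is the column space, which is
  spanned by a maximal independent set of columns, listed without repetition.\<close>

lemma card_image_mult_mat_vec:
  fixes P :: "'a :: {field, finite} mat"
  assumes P: "P \<in> carrier_mat n m"
  shows "card ((*\<^sub>v) P ` carrier_vec m) = CARD('a) ^ vec_space.rank n P"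
proof -
  interpret vec_space "TYPE('a)" n .
  let ?C = "set (cols P)"
  have C: "?C \<subseteq> carrier_vec n" using P cols_dim by blast
  \<comment> \<open>Maximality makes \<open>U\<close> span all columns, and
    \<open>rank_card_indpt\<close> identifies its size with the rank.\<close>
  obtain U where U: "maximal U (\<lambda>T. T \<subseteq> ?C \<and> lin_indpt T)"
    using maximal_exists[of "(\<lambda>T. T \<subseteq> ?C \<and> lin_indpt T)" "card ?C" "{}"]
    by (meson List.finite_set card_mono empty_iff empty_subsetI finite_lin_indpt2 rev_finite_subset)
  have UC: "U \<subseteq> ?C" and li: "lin_indpt U" using U by (auto simp: maximal_def)
  have Ucar: "U \<subseteq> carrier_vec n" and Ufin: "finite U" using UC C finite_subset by auto
  have "?C \<subseteq> span U"
  proof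
    fix v assume v: "v \<in> ?C"
    show "v \<in> span U"
    proof (cases "v \<in> U")
      case True
      then show ?thesis using in_own_span[of U] Ucar by auto
    next
      case False
      have "lin_dep (U \<union> {v})" using U v False UC unfolding maximal_def by blast
      then show ?thesis using lin_dep_iff_in_span[of U v] Ucar li v C False by auto
    qed
  qed
  then have sp: "span ?C = span U"
    using span_subsetI[OF Ucar] span_is_monotone[OF UC] by auto
  obtain us where us: "set us = U" "distinct us" using finite_distinct_list[OF Ufin] by auto
  \<comment> \<open>Translation from the set-based notions of the library to
    \<open>indep_list\<close> and \<open>vspan\<close>.\<close>
  have "set vs \<subseteq> carrier_vec n \<and> lin_indpt (set vs) \<and> distinct vs \<Longrightarrow> indep_list n vs \<and> vspan n vs = span (set vs)" for vs
  proof (induction vs)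
    case Nil
    then show ?case by (auto simp: span_empty)
  next
    case (Cons v vs)
    have li': "lin_indpt (set vs)" using subset_li_is_li[of "set (v # vs)" "set vs"] Cons.prems by auto
    then have IH: "indep_list n vs" "vspan n vs = span (set vs)" using Cons by auto
    have "v \<notin> span (set vs)"
      using lin_dep_iff_in_span[of "set vs" v] li' Cons.prems by auto
    moreover have "vspan n (v # vs) = span (set (v # vs))"
    proof -
      have "span (set (v # vs)) = span_list (v # vs)" using span_list_as_span[of "v # vs"] Cons.prems by auto
      also have "\<dots> = {c \<cdot>\<^sub>v v + w | c w. w \<in> span_list vs}"
      proof -
        have "lincomb_list f (v # vs) = f 0 \<cdot>\<^sub>v v + lincomb_list (f \<circ> Suc) vs" for f
          by (simp add: o_def)
        moreover have "c \<cdot>\<^sub>v v + lincomb_list g vs = lincomb_list (case_nat c g) (v # vs)" for c g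
          by (simp add: o_def)
        ultimately show ?thesis unfolding span_list_def by blast
      qed
      also have "span_list vs = span (set vs)" using span_list_as_span[of "vs"] Cons.prems by auto
      finally show ?thesis using IH by simp
    qed
    ultimately show ?case using IH by auto
  qed
  then have ind: "indep_list n us" "vspan n us = span U" using us li Ucar by auto
  have "(*\<^sub>v) P ` carrier_vec m = span ?C"
    using col_space_eq[OF P] P unfolding col_space_def by auto
  also have "\<dots> = vspan n us" using sp ind by simp
  also have "card \<dots> = CARD('a) ^ card U"
    using card_vspan[of us n] ind us Ucar distinct_card[of us] by simp
  also have "card U = rank P" using rank_card_indpt[OF P U] by simp
  finally show ?thesis .
qed

text \<open>Rank-nullity in counted form: the whole space is the preimage of the image, and all
  fibres have the size of the kernel.\<close>

lemma card_ker_mult_image: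
  fixes P :: "'a :: {field, finite} mat"
  assumes P: "P \<in> carrier_mat n m"
  shows "real (card {x \<in> carrier_vec m. P *\<^sub>v x = 0\<^sub>v n}) = CARD('a) ^ m / CARD('a) ^ vec_space.rank n P"
proof -
  have "card {x \<in> carrier_vec m. P *\<^sub>v x = 0\<^sub>v n} * CARD('a) ^ vec_space.rank n P
    = card {x \<in> carrier_vec m. P *\<^sub>v x \<in> (*\<^sub>v) P ` carrier_vec m}"
    using card_vimage_mult_mat_vec[OF P order_refl] card_image_mult_mat_vec[OF P] by simp
  also have "{x \<in> carrier_vec m. P *\<^sub>v x \<in> (*\<^sub>v) P ` carrier_vec m} = carrier_vec m" by auto
  finally have "card {x \<in> carrier_vec m. P *\<^sub>v x = 0\<^sub>v n} * CARD('a) ^ vec_space.rank n P = CARD('a) ^ m"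
    by (simp add: card_carrier_vec)
  then have "real (card {x \<in> carrier_vec m. P *\<^sub>v x = 0\<^sub>v n}) * CARD('a) ^ vec_space.rank n P = CARD('a) ^ m"
    by (metis of_nat_mult of_nat_power)
  then show ?thesis by (simp add: field_simps)
qed

section \<open>Counting tuples that are kept independent\<close>

text \<open>The probability that \<open>j\<close> uniform vectors of an \<open>r\<close>-dimensional
  space over a field of order \<open>q\<close> are independent. The product also covers
  \<open>j > r\<close>, where the factor \<open>i = r\<close> vanishes.\<close>

definition indep_prob :: "real \<Rightarrow> nat \<Rightarrow> nat \<Rightarrow> real" where
  "indep_prob q r j = (\<Prod>i<j. 1 - q ^ i / q ^ r)"

text \<open>Tuples are extended one vector at a time. A new vector is bad exactly if its image lies
  in the span of the images so far, which has \<open>q ^ j\<close> points, and each point has a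
  fibre of the size of the kernel. The bad proportion is therefore
  \<open>q ^ j / q ^ r\<close>.\<close>

lemma card_indep_list_map:
  fixes P :: "'a :: {field, finite} mat"
  assumes P: "P \<in> carrier_mat n m"
  shows "real (card {vs \<in> vec_lists m j. indep_list n (map ((*\<^sub>v) P) vs)})
    = CARD('a) ^ (m * j) * indep_prob CARD('a) (vec_space.rank n P) j"
proof (induction j)
  case 0
  have "{vs \<in> vec_lists m 0. indep_list n (map ((*\<^sub>v) P) vs)} = {[]}"
    by (auto simp: vec_lists_0)
  then show ?case by (simp add: indep_prob_def)
next
  case (Suc j)
  let ?q = "real CARD('a)" and ?r = "vec_space.rank n P"
  let ?L = "\<lambda>j. {vs \<in> vec_lists m j. indep_list n (map ((*\<^sub>v) P) vs)}"
  let ?N = "\<lambda>vs. {v \<in> carrier_vec m. P *\<^sub>v v \<notin> vspan n (map ((*\<^sub>v) P) vs)}"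
  have N: "real (card (?N vs)) = ?q ^ m * (1 - ?q ^ j / ?q ^ ?r)" if vs: "vs \<in> ?L j" for vs
  proof -
    let ?S = "vspan n (map ((*\<^sub>v) P) vs)"
    have l: "set vs \<subseteq> carrier_vec m" "length vs = j" using vs by (auto simp: vec_lists_def)
    have sub: "?S \<subseteq> (*\<^sub>v) P ` carrier_vec m"
      unfolding vspan_map_mult[OF P l(1)] using vspan_closed[OF l(1)] by auto
    have "set (map ((*\<^sub>v) P) vs) \<subseteq> carrier_vec n"
      using map_mult_in_vec_lists[OF P, of vs j] vs by (simp add: vec_lists_def)
    from card_vspan[OF this] have cS: "card ?S = CARD('a) ^ j" using vs l by simp
    have "?N vs = carrier_vec m - {v \<in> carrier_vec m. P *\<^sub>v v \<in> ?S}" by auto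
    also have "real (card \<dots>) = real (card (carrier_vec m :: 'a vec set)) - real (card {v \<in> carrier_vec m. P *\<^sub>v v \<in> ?S})"
      by (subst card_Diff_subset, force, force, intro of_nat_diff card_mono) auto
    also have "card {v \<in> carrier_vec m. P *\<^sub>v v \<in> ?S} = card {x \<in> carrier_vec m. P *\<^sub>v x = 0\<^sub>v n} * CARD('a) ^ j"
      using card_vimage_mult_mat_vec[OF P sub] cS by simp
    finally show ?thesis
      using card_ker_mult_image[OF P] by (simp add: card_carrier_vec algebra_simps)
  qed
  have "?L (Suc j) = (\<lambda>(vs, v). v # vs) ` (SIGMA vs:?L j. ?N vs)"
    unfolding vec_lists_Suc by (force simp: image_iff)
  moreover have "inj_on (\<lambda>(vs, v). v # vs) (SIGMA vs:?L j. ?N vs)" by (auto simp: inj_on_def)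
  ultimately have "card (?L (Suc j)) = card (SIGMA vs:?L j. ?N vs)" by (simp add: card_image)
  also have "\<dots> = (\<Sum>vs\<in>?L j. card (?N vs))" by (rule card_SigmaI) auto
  finally have "real (card (?L (Suc j))) = (\<Sum>vs\<in>?L j. real (card (?N vs)))" by simp
  also have "\<dots> = (\<Sum>vs\<in>?L j. ?q ^ m * (1 - ?q ^ j / ?q ^ ?r))" by (intro sum.cong N) auto
  also have "\<dots> = real (card (?L j)) * (?q ^ m * (1 - ?q ^ j / ?q ^ ?r))" by simp
  finally show ?case unfolding Suc by (simp add: indep_prob_def power_add mult_ac)
qed

lemma rank_one_mat: "vec_space.rank n (1\<^sub>m n :: 'a :: field mat) = n"
  using vec_space.det_rank_iff[of "1\<^sub>m n :: 'a mat" n] by simp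

lemma card_indep_list:
  "real (card {vs \<in> vec_lists n j. indep_list n (vs :: 'a :: {field, finite} vec list)})
    = CARD('a) ^ (n * j) * indep_prob CARD('a) n j"
proof -
  have "map ((*\<^sub>v) (1\<^sub>m n)) vs = vs" if "vs \<in> vec_lists n j" for vs :: "'a vec list"
    using that by (intro map_idI) (auto simp: vec_lists_def)
  then have "{vs \<in> vec_lists n j. indep_list n vs} = {vs \<in> vec_lists n j. indep_list n (map ((*\<^sub>v) (1\<^sub>m n :: 'a mat)) vs)}"
    by auto
  then show ?thesis using card_indep_list_map[of "1\<^sub>m n :: 'a mat" n n j] by (simp add: rank_one_mat)
qed

section \<open>A uniform matrix applied to an independent tuple\<close>

lemma finite_carrier_mat [simp]: "finite (carrier_mat n m :: 'a :: finite mat set)"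
  and card_carrier_mat: "card (carrier_mat n m :: 'a :: finite mat set) = CARD('a) ^ (n * m)"
proof -
  have b: "bij_betw cols (carrier_mat n m) (vec_lists n m :: 'a vec list set)"
    unfolding vec_lists_def
  proof (rule bij_betw_byWitness[where f' = "mat_of_cols n"])
    show "cols ` carrier_mat n m \<subseteq> {vs. set vs \<subseteq> carrier_vec n \<and> length vs = m}"
      using cols_dim by (intro image_subsetI) fastforce
  qed auto
  show "finite (carrier_mat n m :: 'a mat set)" using bij_betw_finite[OF b] by simp
  show "card (carrier_mat n m :: 'a mat set) = CARD('a) ^ (n * m)"
    using bij_betw_same_card[OF b] by (simp add: card_vec_lists)
qed

lemma one_less_card_field: "1 < CARD('a :: {field, finite})"
proof -
  have "card {0, 1 :: 'a} \<le> CARD('a)" by (intro card_mono) auto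
  then show ?thesis by simp
qed

text \<open>As long as \<open>j < n\<close>, the span has fewer elements than the whole space, so a
  vector outside it can be prepended.\<close>

lemma indep_list_extend:
  fixes ws :: "'a :: {field, finite} vec list"
  assumes "ws \<in> vec_lists n j" "indep_list n ws"
  shows "\<exists>us. us @ ws \<in> vec_lists n n \<and> indep_list n (us @ ws)"
  using assms
proof (induction "n - j" arbitrary: j ws)
  case 0
  \<comment> \<open>The truncated difference being 0 gives only \<open>n \<le> j\<close>; the other
    inequality comes from comparing sizes.\<close>
  have "card (vspan n ws) \<le> card (carrier_vec n :: 'a vec set)"
    using 0 vspan_closed[of ws n] by (intro card_mono) (auto simp: vec_lists_def)
  then have "CARD('a) ^ j \<le> CARD('a) ^ n"
    using card_vspan[of ws n] 0 by (simp add: card_carrier_vec vec_lists_def)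
  moreover note one_less_card_field[where 'a = 'a]
  ultimately have "j = n" using 0 power_le_imp_le_exp by fastforce
  then show ?case using 0 by (intro exI[of _ "[]"]) simp
next
  case (Suc k)
  note q = one_less_card_field[where 'a = 'a]
  have "card (vspan n ws) = CARD('a) ^ j"
    using card_vspan[of ws n] Suc.prems by (simp add: vec_lists_def)
  also have "\<dots> < card (carrier_vec n :: 'a vec set)"
    using Suc q by (simp add: card_carrier_vec)
  finally have "\<not> carrier_vec n \<subseteq> vspan n ws"
    using Suc.prems vspan_closed[of ws n] card_mono[of "vspan n ws" "carrier_vec n"]
    by (metis (no_types, lifting) finite_carrier_vec finite_subset leD mem_Collect_eq subsetI vec_lists_def)
  then obtain v where v: "v \<in> carrier_vec n" "v \<notin> vspan n ws" by auto
  have "v # ws \<in> vec_lists n (Suc j)" "indep_list n (v # ws)"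
    using v Suc.prems by (auto simp: vec_lists_def)
  moreover have "k = n - Suc j" using Suc.hyps(2) by simp
  ultimately obtain us where "us @ v # ws \<in> vec_lists n n" "indep_list n (us @ v # ws)"
    using Suc.hyps(1)[of "Suc j" "v # ws"] by blast
  then show ?case by (intro exI[of _ "us @ [v]"]) simp
qed

text \<open>A list of \<open>m\<close> independent vectors spans everything, so a matrix is
  determined by its values there. Injectivity suffices, because both sides have the same finite
  size.\<close>

lemma bij_betw_map_mult_basis:
  fixes vs :: "'a :: {field, finite} vec list"
  assumes "vs \<in> vec_lists m m" "indep_list m vs"
  shows "bij_betw (\<lambda>A. map ((*\<^sub>v) A) vs) (carrier_mat n m) (vec_lists n m)"
proof -
  have vs: "set vs \<subseteq> carrier_vec m" using assms by (simp add: vec_lists_def)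
  have "card (vspan m vs) = card (carrier_vec m :: 'a vec set)"
    using card_vspan[OF vs assms(2)] assms(1) by (simp add: card_carrier_vec vec_lists_def)
  then have full: "vspan m vs = carrier_vec m"
    using vspan_closed[OF vs] by (intro card_subset_eq) auto
  have inj: "inj_on (\<lambda>A. map ((*\<^sub>v) A) vs) (carrier_mat n m)"
  proof (rule inj_onI)
    fix A B assume AB: "A \<in> carrier_mat n m" "B \<in> carrier_mat n m" "map ((*\<^sub>v) A) vs = map ((*\<^sub>v) B) vs"
    show "A = B"
      by (rule mat_eqI_mult_vec[OF AB(1,2)])
         (rule mult_mat_vec_eq_on_vspan[OF AB(1,2) vs AB(3)], simp add: full)
  qed
  moreover have "(\<lambda>A. map ((*\<^sub>v) A) vs) ` carrier_mat n m = vec_lists n m"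
  proof (rule card_subset_eq)
    show "card ((\<lambda>A. map ((*\<^sub>v) A) vs) ` carrier_mat n m) = card (vec_lists n m :: 'a vec list set)"
      unfolding card_image[OF inj] card_carrier_mat card_vec_lists ..
    show "(\<lambda>A. map ((*\<^sub>v) A) vs) ` carrier_mat n m \<subseteq> vec_lists n m"
      using map_mult_in_vec_lists assms(1) by blast
  qed simp
  ultimately show ?thesis by (simp add: bij_betw_def)
qed

text \<open>The image of an independent tuple under a uniform matrix is a uniform tuple. After
  completing \<open>ws\<close> to a basis, matrices correspond to arbitrary tuples of images; those
  of the added vectors are free, and \<open>E\<close> restricts only the remaining ones.\<close>

lemma card_mat_map_in:
  fixes ws :: "'a :: {field, finite} vec list"
  assumes ws: "ws \<in> vec_lists m j" "indep_list m ws"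
    and E: "E \<subseteq> vec_lists n j"
  shows "card {A \<in> carrier_mat n m. map ((*\<^sub>v) A) ws \<in> E} * CARD('a) ^ (n * j) = CARD('a) ^ (n * m) * card E"
proof -
  obtain us where us: "us @ ws \<in> vec_lists m m" "indep_list m (us @ ws)"
    using indep_list_extend[OF ws] by auto
  have len: "length ws = j" "length us + j = m" using us ws by (auto simp: vec_lists_def)
  note b = bij_betw_map_mult_basis[OF us, of n]
  let ?X = "{A \<in> carrier_mat n m. map ((*\<^sub>v) A) ws \<in> E}"
  have b': "bij_betw (\<lambda>A. map ((*\<^sub>v) A) (us @ ws)) ?X {bs \<in> vec_lists n m. drop (length us) bs \<in> E}"
  proof (rule bij_betw_subset[OF b])
    let ?f = "\<lambda>A. map ((*\<^sub>v) A) (us @ ws)"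
    have im: "?f ` carrier_mat n m = vec_lists n m" using b by (rule bij_betw_imp_surj_on)
    have dr: "drop (length us) (?f A) = map ((*\<^sub>v) A) ws" for A by simp
    show "?f ` ?X = {bs \<in> vec_lists n m. drop (length us) bs \<in> E}"
      unfolding im[symmetric] dr[symmetric] by blast
  qed (rule Collect_restrict)
  have "bij_betw (\<lambda>(x, y). x @ y) (vec_lists n (length us) \<times> E) {bs \<in> vec_lists n m. drop (length us) bs \<in> E}"
  proof (rule bij_betw_byWitness[where f' = "\<lambda>bs. (take (length us) bs, drop (length us) bs)"])
    show "(\<lambda>(x, y). x @ y) ` ((vec_lists n (length us) :: 'a vec list set) \<times> E) \<subseteq> {bs \<in> vec_lists n m. drop (length us) bs \<in> E}"
    proof clarify
      fix x y :: "'a vec list" assume "x \<in> vec_lists n (length us)" "y \<in> E"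
      moreover from \<open>y \<in> E\<close> have "y \<in> vec_lists n j" using E by blast
      ultimately show "x @ y \<in> vec_lists n m \<and> drop (length us) (x @ y) \<in> E"
        using len by (simp add: vec_lists_def)
    qed
    show "(\<lambda>bs. (take (length us) bs, drop (length us) bs)) ` {bs \<in> vec_lists n m. drop (length us) bs \<in> E}
        \<subseteq> vec_lists n (length us) \<times> E"
      using len set_take_subset[of "length us"] by (fastforce simp: vec_lists_def)
  qed (auto simp: vec_lists_def)
  from bij_betw_same_card[OF this] bij_betw_same_card[OF b']
  have "card ?X = CARD('a) ^ (n * length us) * card E"
    by (simp add: card_cartesian_product card_vec_lists)
  moreover have "n * length us + n * j = n * m" using len by (metis distrib_left)
  then have "CARD('a) ^ (n * length us) * CARD('a) ^ (n * j) = CARD('a) ^ (n * m)"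
    by (metis power_add)
  ultimately show ?thesis by (simp add: mult_ac)
qed

lemma card_mat_indep_list:
  fixes ws :: "'a :: {field, finite} vec list"
  assumes "ws \<in> vec_lists m j" "indep_list m ws"
  shows "real (card {A \<in> carrier_mat n m. indep_list n (map ((*\<^sub>v) A) ws)})
    = card (carrier_mat n m :: 'a mat set) * indep_prob CARD('a) n j"
proof -
  let ?E = "{vs \<in> vec_lists n j. indep_list n (vs :: 'a vec list)}"
  have "{A \<in> carrier_mat n m. indep_list n (map ((*\<^sub>v) A) ws)} = {A \<in> carrier_mat n m. map ((*\<^sub>v) A) ws \<in> ?E}"
    using map_mult_in_vec_lists[OF _ assms(1)] by blast
  then have "real (card {A \<in> carrier_mat n m. indep_list n (map ((*\<^sub>v) A) ws)}) * CARD('a) ^ (n * j)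
     = CARD('a) ^ (n * m) * (CARD('a) ^ (n * j) * indep_prob CARD('a) n j)"
    unfolding card_indep_list[symmetric]
    using arg_cong[OF card_mat_map_in[OF assms, of ?E n], of real] by simp
  then show ?thesis by (simp add: card_carrier_mat)
qed



subsection \<open>Asymptotics of the corank masses\<close>

lemma qpoch_Suc: "qpoch t t (Suc n) = qpoch t t n * (1 - t ^ Suc n)"
  by (simp add: qpoch_def)

text \<open>By Euler's identity these are the coefficients of $(x;t)_\<infinity>$ as a power series
  in x.\<close>

definition L1_coeff :: "real \<Rightarrow> nat \<Rightarrow> real" where
  "L1_coeff t m = (-1) ^ m * t ^ (m choose 2) / qpoch t t m"

text \<open>The weight \<open>1 / t ^ m\<close> absorbs the growth caused by passing from
  \<open>t powi d\<close> to \<open>t powi (d - m)\<close>.\<close>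

definition L1_coeff_norm :: "real \<Rightarrow> real" where
  "L1_coeff_norm t = (\<Sum>m. \<bar>L1_coeff t m\<bar> / t ^ m)"

text \<open>The series of the limit law without its factor \<open>1 / qpoch_inf t t\<close>, indexed
  by the corank itself before the shift by the floor of the logarithm.\<close>

definition L1_series :: "real \<Rightarrow> real \<Rightarrow> int \<Rightarrow> real" where
  "L1_series t y d = (\<Sum>m. L1_coeff t m * exp (- (y * t powi (d - int m))))"

text \<open>The constant of \<open>qpoch_ratio_power_approx\<close>: \<open>t / (1 - t)\<close> pays
  for the finite size \<open>N\<close>, the rest for the error of order
  \<open>1 / s\<close>.\<close>

definition eigenvalue_const :: "real \<Rightarrow> real" where
  "eigenvalue_const t = t / (1 - t) + 1 + 4 / ((1 - t)\<^sup>2 * t\<^sup>2)"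

text \<open>The exponent is \<open>Suc s\<close> because averaging over all tuples contributes one
  factor beyond those of the \<open>s\<close> matrices. The formula serves as a probability only for
  \<open>d \<le> N\<close>.\<close>

definition corank_mass :: "real \<Rightarrow> nat \<Rightarrow> nat \<Rightarrow> nat \<Rightarrow> real" where
  "corank_mass t N s d =
     (\<Sum>m\<le>d. L1_coeff t m * (qpoch t t N / qpoch t t (d - m)) ^ Suc s) / qpoch t t (N - d)"

context
  fixes t :: real
  assumes t: "0 < t" "t < 1"
begin

section \<open>Convergence of the q-Pochhammer symbols\<close>

lemma qpoch_pos: "qpoch t t n > 0"
  by (induction n) (use t power_Suc_less_one[of t] in \<open>auto simp: qpoch_Suc mult.commute qpoch_def[of _ _ 0]\<close>)

text \<open>Going from \<open>N\<close> to \<open>Suc N\<close> subtracts at most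
  \<open>t ^ Suc N\<close>; the right-hand side is the resulting geometric sum.\<close>

lemma qpoch_diff_bounds:
  assumes "n \<le> N"
  shows "qpoch t t N \<le> qpoch t t n" "qpoch t t n - qpoch t t N \<le> (t ^ Suc n - t ^ Suc N) / (1 - t)"
  using assms
proof (induction N rule: dec_induct)
  case (step N)
  have q: "qpoch t t N \<le> 1"
    unfolding qpoch_def by (intro prod_le_1) (use t in \<open>auto simp: power_le_one simp flip: power_Suc\<close>)
  have e: "qpoch t t (Suc N) = qpoch t t N - qpoch t t N * t ^ Suc N"
    by (simp add: qpoch_Suc algebra_simps)
  have "0 \<le> qpoch t t N * t ^ Suc N" using t qpoch_pos[of N] by (intro mult_nonneg_nonneg) auto
  moreover have "qpoch t t N * t ^ Suc N \<le> 1 * t ^ Suc N" using t q by (intro mult_right_mono) auto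
  moreover have "(t ^ Suc N - t ^ Suc (Suc N)) / (1 - t) = t ^ Suc N" using t by (simp add: field_simps)
  ultimately show "qpoch t t (Suc N) \<le> qpoch t t n"
      "qpoch t t n - qpoch t t (Suc N) \<le> (t ^ Suc n - t ^ Suc (Suc N)) / (1 - t)"
    unfolding e using step.IH by (simp_all add: diff_divide_distrib del: power_Suc)
qed auto

lemma qpoch_LIMSEQ: "(\<lambda>n. qpoch t t n) \<longlonglongrightarrow> qpoch_inf t t" and qpoch_inf_pos: "qpoch_inf t t > 0"
proof -
  have cp: "convergent_prod (\<lambda>i. 1 - t * t ^ i)"
    by (intro abs_convergent_prod_imp_convergent_prod summable_imp_abs_convergent_prod)
       (use t in \<open>auto simp: abs_mult intro!: summable_mult summable_geometric\<close>)
  have "(\<lambda>n. \<Prod>i<n. 1 - t * t ^ i) \<longlonglongrightarrow> qpoch_inf t t"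
    unfolding qpoch_inf_def using convergent_prod_LIMSEQ[OF cp] LIMSEQ_lessThan_iff_atMost by blast
  moreover have "(\<Prod>i<n. 1 - t * t ^ i) = qpoch t t n" for n
    by (induction n) (simp_all add: qpoch_Suc, simp add: qpoch_def)
  ultimately show lim: "(\<lambda>n. qpoch t t n) \<longlonglongrightarrow> qpoch_inf t t" by simp
  have "1 - t * t ^ i \<noteq> 0" for i using power_Suc_less_one[of t i] t by simp
  then have "qpoch_inf t t \<noteq> 0" unfolding qpoch_inf_def by (intro prodinf_nonzero cp)
  moreover have "qpoch_inf t t \<ge> 0"
    by (rule LIMSEQ_le_const[OF lim]) (use qpoch_pos in \<open>auto simp: less_imp_le\<close>)
  ultimately show "qpoch_inf t t > 0" by simp
qed

lemma qpoch_inf_le: "qpoch_inf t t \<le> qpoch t t n"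
  by (rule LIMSEQ_le_const2[OF qpoch_LIMSEQ]) (use qpoch_diff_bounds(1) in blast)

lemma qpoch_minus_qpoch_inf_le: "qpoch t t n - qpoch_inf t t \<le> t ^ Suc n / (1 - t)"
proof (rule LIMSEQ_le_const2[OF tendsto_diff[OF tendsto_const qpoch_LIMSEQ]])
  have "qpoch t t n - qpoch t t N \<le> t ^ Suc n / (1 - t)" if "n \<le> N" for N
  proof -
    have "(t ^ Suc n - t ^ Suc N) / (1 - t) \<le> t ^ Suc n / (1 - t)"
      using t by (intro divide_right_mono) auto
    then show ?thesis using qpoch_diff_bounds(2)[OF that] by linarith
  qed
  then show "\<exists>k. \<forall>N\<ge>k. qpoch t t n - qpoch t t N \<le> t ^ Suc n / (1 - t)" by blast
qed

section \<open>Series with the coefficients of the limit law\<close>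

lemma L1_coeff_Suc: "L1_coeff t (Suc m) = - L1_coeff t m * t ^ m / (1 - t ^ Suc m)"
proof -
  have "Suc m choose 2 = m + (m choose 2)" by (simp add: numeral_2_eq_2)
  then show ?thesis unfolding L1_coeff_def qpoch_Suc by (simp add: power_add)
qed

text \<open>The ratio of consecutive terms is \<open>t ^ m / (t * (1 - t ^ Suc m))\<close>, which
  tends to 0.\<close>

lemma summable_L1_coeff: "summable (\<lambda>m. \<bar>L1_coeff t m\<bar> / t ^ m)"
proof -
  have "(\<lambda>m. t ^ m / (t * (1 - t))) \<longlonglongrightarrow> 0 / (t * (1 - t))"
    using t by (intro tendsto_divide LIMSEQ_realpow_zero) auto
  then have "\<forall>\<^sub>F m in sequentially. t ^ m / (t * (1 - t)) < 1 / 2"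
    by (intro order_tendstoD) auto
  then obtain N where N: "\<And>m. m \<ge> N \<Longrightarrow> t ^ m / (t * (1 - t)) < 1 / 2"
    by (auto simp: eventually_sequentially)
  show ?thesis
  proof (rule summable_ratio_test[of "1/2" N])
    fix m assume "m \<ge> N"
    have le: "1 - t \<le> 1 - t ^ Suc m" using t power_decreasing[of 1 "Suc m" t] by simp
    then have p: "0 < 1 - t ^ Suc m" using t by linarith
    have "\<bar>L1_coeff t (Suc m)\<bar> = \<bar>L1_coeff t m\<bar> * t ^ m / (1 - t ^ Suc m)"
      unfolding L1_coeff_Suc using t p by (simp add: abs_mult del: power_Suc)
    then have "\<bar>L1_coeff t (Suc m)\<bar> / t ^ Suc m = \<bar>L1_coeff t m\<bar> / t ^ m * (t ^ m / (t * (1 - t ^ Suc m)))"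
      using t by simp
    also have "\<dots> \<le> \<bar>L1_coeff t m\<bar> / t ^ m * (t ^ m / (t * (1 - t)))"
      using t le p by (intro mult_left_mono divide_left_mono) auto
    also have "\<dots> \<le> \<bar>L1_coeff t m\<bar> / t ^ m * (1 / 2)"
      using t N[OF \<open>m \<ge> N\<close>] by (intro mult_left_mono) auto
    finally show "norm (\<bar>L1_coeff t (Suc m)\<bar> / t ^ Suc m) \<le> 1 / 2 * norm (\<bar>L1_coeff t m\<bar> / t ^ m)"
      using t by simp
  qed simp
qed

text \<open>This is Euler's series at x = 1, where the first factor of the product vanishes.\<close>

lemma L1_coeff_sums_0: "L1_coeff t sums 0"
proof -
  have ch: "Suc m choose 2 = m + (m choose 2)" for m by (simp add: numeral_2_eq_2)
  \<comment> \<open>The partial sums have a closed form, and \<open>Suc n choose 2\<close> is at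
    least \<open>n\<close>, so they decay like \<open>t ^ n\<close>.\<close>
  have s: "(\<Sum>m\<le>n. L1_coeff t m) = (-1) ^ n * t ^ (Suc n choose 2) / qpoch t t n" for n
  proof (induction n)
    case 0
    show ?case by (simp add: L1_coeff_def numeral_2_eq_2)
  next
    case (Suc n)
    have "1 - t ^ Suc n \<noteq> 0" using power_Suc_less_one[of t n] t by simp
    moreover have "(\<Sum>m\<le>Suc n. L1_coeff t m)
      = (-1) ^ n * t ^ (Suc n choose 2) / qpoch t t n + (-1) ^ Suc n * t ^ (Suc n choose 2) / (qpoch t t n * (1 - t ^ Suc n))"
      using Suc by (simp add: L1_coeff_def qpoch_Suc)
    ultimately show ?case unfolding ch[of "Suc n"] qpoch_Suc using qpoch_pos[of n]
      by (simp add: field_simps power_add)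
  qed
  have "(\<lambda>n. \<Sum>m\<le>n. L1_coeff t m) \<longlonglongrightarrow> 0"
  proof (rule Lim_null_comparison[OF always_eventually])
    show "(\<lambda>n. t ^ n / qpoch_inf t t) \<longlonglongrightarrow> 0"
      using t by (intro tendsto_divide_zero LIMSEQ_realpow_zero) auto
    show "\<forall>n. norm (\<Sum>m\<le>n. L1_coeff t m) \<le> t ^ n / qpoch_inf t t"
    proof
      fix n
      have "norm (\<Sum>m\<le>n. L1_coeff t m) = t ^ (Suc n choose 2) / qpoch t t n"
        unfolding s using t qpoch_pos[of n] by (simp add: abs_mult)
      also have "\<dots> \<le> t ^ n / qpoch_inf t t"
        unfolding ch using t qpoch_inf_pos qpoch_inf_le[of n]
        by (intro frac_le power_decreasing) auto
      finally show "norm (\<Sum>m\<le>n. L1_coeff t m) \<le> t ^ n / qpoch_inf t t" .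
    qed
  qed
  then show ?thesis unfolding sums_def LIMSEQ_lessThan_iff_atMost .
qed

lemma L1_coeff_norm_nonneg: "L1_coeff_norm t \<ge> 0"
  unfolding L1_coeff_norm_def by (intro suminf_nonneg summable_L1_coeff) (use t in auto)

text \<open>The common tool for all estimates below: a termwise bound that may grow like
  \<open>1 / t ^ m\<close> passes to the sum.\<close>

lemma abs_L1_coeff_series_le:
  assumes "\<And>m. \<bar>f m\<bar> \<le> B / t ^ m"
  shows "summable (\<lambda>m. L1_coeff t m * f m)" "\<bar>\<Sum>m. L1_coeff t m * f m\<bar> \<le> L1_coeff_norm t * B"
proof -
  have le: "\<bar>L1_coeff t m * f m\<bar> \<le> \<bar>L1_coeff t m\<bar> / t ^ m * B" for m
    using mult_left_mono[OF assms[of m], of "\<bar>L1_coeff t m\<bar>"] by (simp add: abs_mult)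
  have s: "summable (\<lambda>m. \<bar>L1_coeff t m\<bar> / t ^ m * B)" by (intro summable_mult2 summable_L1_coeff)
  show "summable (\<lambda>m. L1_coeff t m * f m)"
    by (rule summable_comparison_test'[OF s]) (use le in auto)
  show "\<bar>\<Sum>m. L1_coeff t m * f m\<bar> \<le> L1_coeff_norm t * B"
    using norm_suminf_le[OF _ s, of "\<lambda>m. L1_coeff t m * f m"] le suminf_mult2[OF summable_L1_coeff]
    unfolding L1_coeff_norm_def by simp
qed

lemma le_divide_power: "0 \<le> B \<Longrightarrow> B \<le> B / t ^ m"
  using t divide_left_mono[of "t ^ m" 1 B] by (simp add: power_le_one)

text \<open>The coefficients sum to 0, so 1 may be subtracted from every exponential, and $|e^{-u} -
  1| \<le> u$ then gains the factor \<open>t powi d\<close>. This controls large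
  \<open>d\<close>.\<close>

lemma L1_series_le_small:
  assumes "y \<ge> 0"
  shows "\<bar>L1_series t y d\<bar> \<le> L1_coeff_norm t * (y * t powi d)"
proof -
  have b: "\<bar>exp (- (y * t powi (d - int m))) - 1\<bar> \<le> y * t powi d / t ^ m" for m
  proof -
    define u where "u = y * t powi (d - int m)"
    have "u \<ge> 0" using assms t by (simp add: u_def)
    then have "\<bar>exp (- u) - 1\<bar> \<le> u" using exp_ge_add_one_self[of "- u"] by simp
    then show ?thesis using t by (simp add: u_def power_int_diff)
  qed
  have sm: "summable (L1_coeff t)" using L1_coeff_sums_0 by (rule sums_summable)
  have e1: "\<bar>exp (- (y * t powi (d - int m)))\<bar> \<le> 1 / t ^ m" for m
  proof -
    have "exp (- (y * t powi (d - int m))) \<le> 1" using assms t by simp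
    moreover have "1 \<le> 1 / t ^ m" using le_divide_power[of 1 m] by simp
    ultimately show ?thesis unfolding abs_exp_cancel by linarith
  qed
  have "L1_series t y d = (\<Sum>m. L1_coeff t m * exp (- (y * t powi (d - int m)))) - (\<Sum>m. L1_coeff t m)"
    using L1_coeff_sums_0 by (simp add: L1_series_def sums_iff)
  also have "\<dots> = (\<Sum>m. L1_coeff t m * (exp (- (y * t powi (d - int m))) - 1))"
    using suminf_diff[OF abs_L1_coeff_series_le(1)[OF e1] sm] by (simp add: algebra_simps)
  also have "\<bar>\<dots>\<bar> \<le> L1_coeff_norm t * (y * t powi d)"
    by (rule abs_L1_coeff_series_le(2)[OF b])
  finally show ?thesis .
qed

lemma exp_minus_le: "0 < y \<Longrightarrow> exp (- y) \<le> 1 / (y :: real)"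
  using order_trans[OF _ exp_ge_add_one_self[of y], of y] by (simp add: exp_minus divide_simps)

text \<open>For negative \<open>d\<close> every power of \<open>t\<close> in the exponents is at
  least 1, so each exponential is at most \<open>exp (- y)\<close>.\<close>

lemma L1_series_le_neg:
  assumes "y > 0" "d < 0"
  shows "\<bar>L1_series t y d\<bar> \<le> L1_coeff_norm t * (1 / y)"
  unfolding L1_series_def
proof (rule abs_L1_coeff_series_le(2))
  fix m
  have "1 \<le> t powi (d - int m)"
    using t assms one_le_power[of "inverse t" "nat (int m - d)"]
    by (auto simp: power_int_def one_le_inverse)
  then have "exp (- (y * t powi (d - int m))) \<le> exp (- y)" using assms by simp
  also have "\<dots> \<le> 1 / y" using exp_minus_le assms by simp
  also have "\<dots> \<le> 1 / y / t ^ m" using le_divide_power[of "1 / y" m] assms by simp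
  finally show "\<bar>exp (- (y * t powi (d - int m)))\<bar> \<le> 1 / y / t ^ m" by simp
qed

section \<open>Powers of q-Pochhammer ratios against exponentials\<close>

text \<open>The ratio is a product of factors 1 - x with x running over powers of \<open>t\<close>.
  Each factor lies between exp(-x/(1-x)) and exp(-x), and x/(1-x) exceeds x by at most x^2/(1-t).
  The x add up to \<open>X\<close>, their squares to at most
  \<open>(t ^ e)\<^sup>2 / (1 - t)\<close>.\<close>

lemma qpoch_ratio_bounds:
  assumes "e \<le> N"
  defines "X \<equiv> (t ^ Suc e - t ^ Suc N) / (1 - t)"
  shows "qpoch t t N / qpoch t t e \<le> exp (- X)"
    and "exp (- X - (t ^ e)\<^sup>2 / (1 - t)\<^sup>2) \<le> qpoch t t N / qpoch t t e"
proof -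
  \<comment> \<open>\<open>X\<close> as a function of the upper index, so that the induction can
    vary \<open>N\<close> with \<open>e\<close> fixed.\<close>
  define Y where "Y = (\<lambda>N. (t ^ Suc e - t ^ Suc N) / (1 - t))"
  have Ysuc: "Y (Suc N) = Y N + t ^ Suc N" for N
    using t by (simp add: Y_def field_simps)
  have "qpoch t t N / qpoch t t e \<le> exp (- Y N) \<and>
    exp (- Y N - (\<Sum>i=e..<N. (t ^ Suc i)\<^sup>2) / (1 - t)) \<le> qpoch t t N / qpoch t t e"
    using assms(1)
  proof (induction N rule: dec_induct)
    case base
    then show ?case using qpoch_pos[of e] by (simp add: Y_def)
  next
    case (step N)
    define x where "x = t ^ Suc N"
    have x: "0 < x" "x \<le> t" using t power_decreasing[of 1 "Suc N" t] by (simp_all add: x_def)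
    have up: "1 - x \<le> exp (- x)" using exp_ge_add_one_self[of "- x"] by simp
    have "x * x / (1 - x) \<le> x * x / (1 - t)"
      using x t by (intro divide_left_mono) auto
    moreover have "x / (1 - x) = x + x * x / (1 - x)" using x t by (simp add: field_simps)
    ultimately have "exp (- x - x\<^sup>2 / (1 - t)) \<le> exp (- (x / (1 - x)))"
      by (simp add: power2_eq_square)
    also have "\<dots> \<le> 1 - x"
    proof -
      have "1 / (1 - x) \<le> exp (x / (1 - x))"
        using exp_ge_add_one_self[of "x / (1 - x)"] x t by (simp add: field_simps)
      then show ?thesis using x t by (simp add: exp_minus field_simps)
    qed
    finally have lo: "exp (- x - x\<^sup>2 / (1 - t)) \<le> 1 - x" .
    have eq: "qpoch t t (Suc N) / qpoch t t e = qpoch t t N / qpoch t t e * (1 - x)"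
      by (simp add: qpoch_Suc x_def)
    have "qpoch t t N / qpoch t t e * (1 - x) \<le> exp (- Y N) * exp (- x)"
      using step.IH up x t by (intro mult_mono) auto
    also have "\<dots> = exp (- Y (Suc N))" by (simp add: Ysuc x_def flip: exp_add)
    finally have 1: "qpoch t t N / qpoch t t e * (1 - x) \<le> exp (- Y (Suc N))" .
    have "exp (- Y (Suc N) - (\<Sum>i=e..<Suc N. (t ^ Suc i)\<^sup>2) / (1 - t))
      = exp (- Y N - (\<Sum>i=e..<N. (t ^ Suc i)\<^sup>2) / (1 - t)) * exp (- x - x\<^sup>2 / (1 - t))"
      using step.hyps by (simp add: Ysuc x_def add_divide_distrib algebra_simps flip: exp_add)
    also have "\<dots> \<le> qpoch t t N / qpoch t t e * (1 - x)"
      using step.IH lo qpoch_pos[of N] qpoch_pos[of e] by (intro mult_mono) auto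
    finally show ?case using 1 unfolding eq by simp
  qed
  moreover have "(\<Sum>i=e..<N. (t ^ Suc i)\<^sup>2) \<le> (t ^ e)\<^sup>2 / (1 - t)"
  proof -
    have "(\<Sum>i=e..<N. (t ^ Suc i)\<^sup>2) \<le> (\<Sum>i=e..<N. (t ^ e)\<^sup>2 * t ^ (i - e))"
    proof (rule sum_mono)
      fix i assume i: "i \<in> {e..<N}"
      have "(t ^ Suc i)\<^sup>2 = t ^ (2 * Suc i)" by (simp only: mult.commute flip: power_mult)
      also have "\<dots> \<le> t ^ (2 * e + (i - e))" using t i by (intro power_decreasing) auto
      also have "\<dots> = (t ^ e)\<^sup>2 * t ^ (i - e)" by (simp add: power_add power_mult mult.commute flip: power_mult)
      finally show "(t ^ Suc i)\<^sup>2 \<le> (t ^ e)\<^sup>2 * t ^ (i - e)" .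
    qed
    also have "\<dots> = (t ^ e)\<^sup>2 * (\<Sum>j<N - e. t ^ j)"
      unfolding sum_distrib_left
      by (rule sum.reindex_bij_witness[of _ "\<lambda>j. j + e" "\<lambda>i. i - e"]) auto
    also have "\<dots> \<le> (t ^ e)\<^sup>2 * (1 / (1 - t))"
      using t sum_gp_strict[of t "N - e"] by (intro mult_left_mono) (simp_all add: divide_right_mono)
    finally show ?thesis by simp
  qed
  then have "(\<Sum>i=e..<N. (t ^ Suc i)\<^sup>2) / (1 - t) \<le> (t ^ e)\<^sup>2 / (1 - t)\<^sup>2"
    using t by (simp add: power2_eq_square divide_right_mono flip: divide_divide_eq_left)
  then have "exp (- Y N - (t ^ e)\<^sup>2 / (1 - t)\<^sup>2) \<le> exp (- Y N - (\<Sum>i=e..<N. (t ^ Suc i)\<^sup>2) / (1 - t))" by simp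
  ultimately show "qpoch t t N / qpoch t t e \<le> exp (- X)"
    "exp (- X - (t ^ e)\<^sup>2 / (1 - t)\<^sup>2) \<le> qpoch t t N / qpoch t t e"
    unfolding X_def Y_def by (blast, blast intro: order_trans)
qed

text \<open>The ratio is about \<open>exp (- X)\<close>. The target exponent is
  \<open>S * X + h\<close>, where \<open>h\<close> pays for \<open>N\<close> being finite. All other
  errors are damped by \<open>exp (- (S * X))\<close>, which makes them of order
  \<open>1 / S\<close> uniformly in \<open>e\<close>.\<close>

lemma qpoch_ratio_power_approx:
  fixes s N e :: nat
  assumes e: "e \<le> N" and s: "s \<ge> 1"
  shows "\<bar>(qpoch t t N / qpoch t t e) ^ Suc s - exp (- (s * t / (1 - t) * t ^ e))\<bar>
    \<le> eigenvalue_const t * (1 / s + s * t ^ N)"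
proof -
  define u where "u = t ^ e"
  define X where "X = (t ^ Suc e - t ^ Suc N) / (1 - t)"
  define b where "b = 1 / (1 - t)\<^sup>2"
  define F where "F = qpoch t t N / qpoch t t e"
  define h where "h = s * t ^ Suc N / (1 - t)"
  define S where "S = real s"
  have S: "S \<ge> 1" using s by (simp add: S_def)
  have u: "u > 0" and b: "b > 0" and h: "h \<ge> 0" using t by (simp_all add: u_def b_def h_def)
  have X: "X \<ge> 0" using t e by (auto simp: X_def intro!: power_decreasing simp del: power_Suc)
  have F: "F \<le> exp (- X)" "exp (- X - b * u\<^sup>2) \<le> F" "F > 0"
    using qpoch_ratio_bounds[OF e] qpoch_pos by (simp_all add: F_def X_def b_def u_def)
  have yu: "s * t / (1 - t) * t ^ e = S * X + h"
    using t by (simp add: X_def h_def S_def diff_divide_distrib algebra_simps)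
  have hb: "h = t / (1 - t) * (S * t ^ N)" by (simp add: h_def S_def)
  have eh: "1 - h \<le> exp (- h)" "exp (- h) \<le> 1" using exp_ge_add_one_self[of "- h"] h by simp_all
  have pe: "exp (c * real n) = exp c ^ n" for c :: real and n by (simp add: exp_of_nat2_mult)
  have "F ^ Suc s - exp (- (S * X + h)) \<le> h"
  proof -
    have "F ^ Suc s \<le> exp (- X) ^ Suc s" using F by (intro power_mono) auto
    also have "\<dots> \<le> exp (- X) ^ s" using X by (intro power_decreasing) auto
    also have "\<dots> = exp (- (S * X))" unfolding pe[symmetric] by (simp add: S_def mult.commute)
    finally have "F ^ Suc s \<le> exp (- (S * X))" .
    moreover have "exp (- (S * X)) * (1 - h) \<le> exp (- (S * X)) * exp (- h)"
      using eh by (intro mult_left_mono) auto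
    moreover have "exp (- (S * X)) * h \<le> 1 * h" using X S h by (intro mult_right_mono) auto
    ultimately show ?thesis by (simp add: algebra_simps flip: exp_add)
  qed
  moreover have "exp (- (S * X + h)) - F ^ Suc s \<le> (1 + 4 * b / t\<^sup>2) / S"
  \<comment> \<open>For \<open>e = N\<close> one has \<open>X = 0\<close>, so the bound
    \<open>t * u \<le> X\<close> of the other case fails, but the ratio is exactly 1.\<close>
  proof (cases "e = N")
    case True
    then have "F = 1" using qpoch_pos[of N] by (simp add: F_def)
    moreover have "0 \<le> S * X + h" using S X h by simp
    then have "exp (- (S * X + h)) \<le> 1" by simp
    moreover have "0 \<le> (1 + 4 * b / t\<^sup>2) / S" using b S by auto
    ultimately show ?thesis unfolding power_one \<open>F = 1\<close> by linarith
  next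
    case False
    have tu: "t * u \<le> X"
    proof -
      have "t ^ Suc N \<le> t ^ Suc (Suc e)" using t e False by (intro power_decreasing) auto
      then have "t * u * (1 - t) \<le> t ^ Suc e - t ^ Suc N" by (simp add: u_def algebra_simps)
      then show ?thesis using t by (simp add: X_def field_simps)
    qed
    \<comment> \<open>The lower bound on \<open>F\<close> to the power \<open>S + 1\<close>,
      linearised: the lone \<open>X\<close> stems from the surplus factor.\<close>
    have "exp (- (S * X)) * (1 - (X + (S + 1) * b * u\<^sup>2)) \<le> exp (- (S * X)) * exp (- (X + (S + 1) * b * u\<^sup>2))"
    proof (rule mult_left_mono)
      show "1 - (X + (S + 1) * b * u\<^sup>2) \<le> exp (- (X + (S + 1) * b * u\<^sup>2))"
        using exp_ge_add_one_self[of "- (X + (S + 1) * b * u\<^sup>2)"] by linarith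
    qed simp
    also have "\<dots> = exp ((- X - b * u\<^sup>2) * real (Suc s))"
      by (simp add: S_def algebra_simps flip: exp_add)
    also have "\<dots> \<le> F ^ Suc s" unfolding pe using F by (intro power_mono) auto
    finally have "exp (- (S * X)) - F ^ Suc s \<le> exp (- (S * X)) * (X + (S + 1) * b * u\<^sup>2)"
      by (simp add: algebra_simps)
    also have "\<dots> = exp (- (S * X)) * X + exp (- (S * X)) * ((S + 1) * b * u\<^sup>2)"
      by (simp add: algebra_simps)
    also have "\<dots> \<le> 1 / S + 4 * b / t\<^sup>2 / S"
    proof (rule add_mono)
      have "X * S \<le> exp (S * X)" using exp_ge_add_one_self[of "S * X"] unfolding mult.commute[of X S] by linarith
      then show "exp (- (S * X)) * X \<le> 1 / S" using S by (simp add: exp_minus field_simps)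
      \<comment> \<open>With \<open>w = S * (t * u) \<le> S * X\<close> and
        \<open>S + 1 \<le> 2 * S\<close>, the product becomes \<open>exp (- w) * w\<^sup>2\<close>
        times \<open>2 * b / (S * t\<^sup>2)\<close>. The first factor is at most 2, whence the
        4.\<close>
      have "exp (- (S * X)) * ((S + 1) * b * u\<^sup>2) \<le> exp (- (S * (t * u))) * ((2 * S) * b * u\<^sup>2)"
        using S tu b u t by (intro mult_mono mult_right_mono) auto
      also have "\<dots> \<le> 4 * b / t\<^sup>2 / S"
      proof -
        define w where "w = S * (t * u)"
        have w: "w > 0" using S t u by (simp add: w_def)
        have "w\<^sup>2 / 2 \<le> exp w" using exp_lower_Taylor_quadratic[of w] w by simp
        then have "exp (- w) * w\<^sup>2 \<le> 2" by (simp add: exp_minus field_simps)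
        then have "exp (- w) * w\<^sup>2 * (2 * b / (S * t\<^sup>2)) \<le> 2 * (2 * b / (S * t\<^sup>2))"
          using b S by (intro mult_right_mono) auto
        moreover have "exp (- w) * w\<^sup>2 * (2 * b / (S * t\<^sup>2)) = exp (- w) * ((2 * S) * b * u\<^sup>2)"
          using S t by (simp add: w_def power2_eq_square field_simps)
        moreover have "2 * (2 * b / (S * t\<^sup>2)) = 4 * b / t\<^sup>2 / S" by simp
        ultimately show ?thesis unfolding w_def[symmetric] by linarith
      qed
      finally show "exp (- (S * X)) * ((S + 1) * b * u\<^sup>2) \<le> 4 * b / t\<^sup>2 / S" .
    qed
    also have "\<dots> = (1 + 4 * b / t\<^sup>2) / S" by (simp add: add_divide_distrib)
    finally have "exp (- (S * X)) - F ^ Suc s \<le> (1 + 4 * b / t\<^sup>2) / S" .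
    moreover have "exp (- (S * X + h)) \<le> exp (- (S * X))" using h by simp
    ultimately show ?thesis by linarith
  qed
  moreover have "h + (1 + 4 * b / t\<^sup>2) / S \<le> eigenvalue_const t * (1 / S + S * t ^ N)"
  proof -
    have "eigenvalue_const t = t / (1 - t) + (1 + 4 * b / t\<^sup>2)"
      by (simp add: eigenvalue_const_def b_def field_simps)
    moreover have "0 \<le> t / (1 - t) * (1 / S)" "0 \<le> (1 + 4 * b / t\<^sup>2) * (S * t ^ N)"
      using t b S by (auto intro!: mult_nonneg_nonneg)
    moreover have "(a + c) * (1 / S + v) = a * v + c / S + (a * (1 / S) + c * v)" for a c v
      by (simp add: algebra_simps add_divide_distrib)
    ultimately show ?thesis unfolding hb by simp
  qed
  moreover have "0 \<le> (1 + 4 * b / t\<^sup>2) / S" using b S by auto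
  ultimately show ?thesis
    unfolding yu F_def[symmetric] using h by (simp add: S_def abs_le_iff)
qed

section \<open>Uniform error bound for the corank masses\<close>

text \<open>Both quantities are series with the same coefficients once the finite sum is padded with
  zeros, so they can be compared term by term.\<close>

lemma corank_mass_numerator_approx:
  assumes d: "d \<le> N" and s: "s \<ge> 1"
  shows "\<bar>corank_mass t N s d * qpoch t t (N - d) - L1_series t (s * t / (1 - t)) (int d)\<bar>
    \<le> L1_coeff_norm t * ((eigenvalue_const t + 1) * (1 / s + s * t ^ N))"
proof -
  define y where "y = s * t / (1 - t)"
  define \<delta> where "\<delta> = 1 / s + s * t ^ N"
  define F where "F m = (if m \<le> d then (qpoch t t N / qpoch t t (d - m)) ^ Suc s else 0)" for m
  have y: "y > 0" using t s by (simp add: y_def)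
  have d0: "\<delta> > 0" using t s by (auto simp: \<delta>_def intro!: add_pos_nonneg)
  have ec: "eigenvalue_const t \<ge> 0" using t by (simp add: eigenvalue_const_def)
  have le: "\<bar>F m - exp (- (y * t powi (int d - int m)))\<bar> \<le> (eigenvalue_const t + 1) * \<delta> / t ^ m" for m
  proof -
    have "\<bar>F m - exp (- (y * t powi (int d - int m)))\<bar> \<le> (eigenvalue_const t + 1) * \<delta>"
    proof (cases "m \<le> d")
      case True
      then have "t powi (int d - int m) = t ^ (d - m)" by (simp flip: of_nat_diff)
      then have "\<bar>F m - exp (- (y * t powi (int d - int m)))\<bar> \<le> eigenvalue_const t * \<delta>"
        using qpoch_ratio_power_approx[of "d - m" N s] True d s by (simp add: F_def y_def \<delta>_def del: power_Suc)
      then show ?thesis using d0 by (simp add: algebra_simps)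
    next
      case False
      \<comment> \<open>Padded terms: since \<open>m > d\<close>, the exponent is at least
        \<open>y / t = s / (1 - t) \<ge> s\<close>, so the exponential is at most
        \<open>1 / s\<close>. The \<open>+ 1\<close> in the constant leaves room for this.\<close>
      have "inverse t \<le> inverse t ^ nat (int m - int d)"
        using power_increasing[of 1 "nat (int m - int d)" "inverse t"] t False by (simp add: one_le_inverse)
      then have "1 / t \<le> t powi (int d - int m)"
        using t False by (simp add: power_int_def divide_inverse)
      then have "s / (1 - t) \<le> y * t powi (int d - int m)"
        using mult_left_mono[of "1 / t" "t powi (int d - int m)" y] y t by (simp add: y_def)
      moreover have "s \<le> s / (1 - t)" using t s by (simp add: field_simps)
      ultimately have "exp (- (y * t powi (int d - int m))) \<le> exp (- real s)" by simp
      also have "\<dots> \<le> 1 / s" using exp_minus_le s by simp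
      also have "\<dots> \<le> \<delta>" using t by (simp add: \<delta>_def)
      also have "\<dots> \<le> (eigenvalue_const t + 1) * \<delta>" using ec d0 by (simp add: algebra_simps)
      finally show ?thesis using False by (simp add: F_def)
    qed
    also have "\<dots> \<le> (eigenvalue_const t + 1) * \<delta> / t ^ m"
      by (rule le_divide_power) (use ec d0 in auto)
    finally show ?thesis .
  qed
  have "(\<lambda>m. L1_coeff t m * F m) sums (\<Sum>m\<le>d. L1_coeff t m * F m)"
    by (rule sums_finite) (auto simp: F_def)
  moreover have "(\<Sum>m\<le>d. L1_coeff t m * F m) = corank_mass t N s d * qpoch t t (N - d)"
    using qpoch_pos[of "N - d"] by (simp add: corank_mass_def F_def del: power_Suc)
  ultimately have F: "(\<lambda>m. L1_coeff t m * F m) sums (corank_mass t N s d * qpoch t t (N - d))" by simp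
  have e1: "\<bar>exp (- (y * t powi (int d - int m)))\<bar> \<le> 1 / t ^ m" for m
  proof -
    have "exp (- (y * t powi (int d - int m))) \<le> 1" using y t by simp
    moreover have "1 \<le> 1 / t ^ m" using le_divide_power[of 1 m] by simp
    ultimately show ?thesis unfolding abs_exp_cancel by linarith
  qed
  have "(\<lambda>m. L1_coeff t m * exp (- (y * t powi (int d - int m)))) sums L1_series t y (int d)"
    unfolding L1_series_def by (rule summable_sums) (rule abs_L1_coeff_series_le(1)[OF e1])
  from sums_diff[OF F this]
  have "corank_mass t N s d * qpoch t t (N - d) - L1_series t y (int d)
    = (\<Sum>m. L1_coeff t m * (F m - exp (- (y * t powi (int d - int m)))))"
    by (simp add: sums_iff algebra_simps)
  then show ?thesis using abs_L1_coeff_series_le(2)[OF le] unfolding y_def \<delta>_def by simp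
qed

text \<open>The constant must not depend on \<open>d\<close>, for the sake of the supremum. Outside
  the range from 0 to \<open>N\<close> the series itself is small; inside it, the denominator is
  moved to its limit. Nonnegativity of the masses, which are probabilities in the application, lets
  the bound on \<open>R - Q\<close> be multiplied by \<open>P\<close>.\<close>

lemma corank_mass_approx:
  "\<exists>C. \<forall>N s d. 1 \<le> s \<longrightarrow> (\<forall>d\<le>N. corank_mass t N s d \<ge> 0) \<longrightarrow>
     \<bar>(if 0 \<le> d \<and> d \<le> int N then corank_mass t N s (nat d) else 0)
       - L1_series t (s * t / (1 - t)) d / qpoch_inf t t\<bar> \<le> C * (1 / real s + real s * t ^ N)"
proof -
  define K where "K = L1_coeff_norm t"
  define Q where "Q = qpoch_inf t t"
  define C2 where "C2 = K * (eigenvalue_const t + 1)"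
  \<comment> \<open>\<open>C3\<close>, \<open>C4\<close> and \<open>C5\<close> belong to the ranges
    from 0 to \<open>N\<close>, above \<open>N\<close> and below 0. In \<open>C3\<close> the second
    summand pays for the change of denominator.\<close>
  define C3 where "C3 = C2 / Q + (K * (t / (1 - t)) + C2) / Q / (1 - t) / Q"
  define C4 where "C4 = K * (t / (1 - t)) / Q"
  define C5 where "C5 = K * ((1 - t) / t) / Q"
  have K: "K \<ge> 0" using L1_coeff_norm_nonneg by (simp add: K_def)
  have Q: "Q > 0" using qpoch_inf_pos by (simp add: Q_def)
  have C2: "C2 \<ge> 0" using K t by (simp add: C2_def eigenvalue_const_def)
  have nn: "C3 \<ge> 0" "C4 \<ge> 0" "C5 \<ge> 0" using K Q C2 t by (simp_all add: C3_def C4_def C5_def)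
  have "\<bar>(if 0 \<le> d \<and> d \<le> int N then corank_mass t N s (nat d) else 0)
       - L1_series t (s * t / (1 - t)) d / Q\<bar> \<le> (C3 + C4 + C5) * (1 / real s + real s * t ^ N)"
    if s: "1 \<le> s" and P0: "\<forall>d\<le>N. corank_mass t N s d \<ge> 0" for N s d
  proof -
    define y where "y = s * t / (1 - t)"
    define \<delta> where "\<delta> = 1 / real s + real s * t ^ N"
    have y: "y > 0" using t s by (simp add: y_def)
    have \<delta>: "0 < \<delta>" "1 / s \<le> \<delta>" "s * t ^ N \<le> \<delta>" using t s by (auto simp: \<delta>_def intro!: add_pos_nonneg)
    have ytN: "y * t ^ N \<le> t / (1 - t) * \<delta>"
      using mult_left_mono[OF \<delta>(3), of "t / (1 - t)"] t by (simp add: y_def mult_ac)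
    have mono: "C3 * \<delta> \<le> (C3 + C4 + C5) * \<delta>" "C4 * \<delta> \<le> (C3 + C4 + C5) * \<delta>" "C5 * \<delta> \<le> (C3 + C4 + C5) * \<delta>"
      using nn \<delta> by (auto intro!: mult_right_mono)
    consider "d < 0" | "d > int N" | n where "d = int n" "n \<le> N"
      by (metis linorder_not_less of_nat_le_iff zero_le_imp_eq_int)
    then show ?thesis
    proof cases
      case 1
      have "1 / y = (1 - t) / t * (1 / s)" by (simp add: y_def)
      also have "\<dots> \<le> (1 - t) / t * \<delta>" using t \<delta> by (intro mult_left_mono) auto
      finally have "K * (1 / y) \<le> K * ((1 - t) / t * \<delta>)" using K by (rule mult_left_mono)
      then have "\<bar>L1_series t y d\<bar> \<le> K * ((1 - t) / t * \<delta>)"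
        using L1_series_le_neg[OF y 1] by (simp add: K_def)
      then have "\<bar>L1_series t y d\<bar> / Q \<le> K * ((1 - t) / t * \<delta>) / Q"
        using Q by (intro divide_right_mono) auto
      then have "\<bar>L1_series t y d / Q\<bar> \<le> C5 * \<delta>" using Q by (simp add: C5_def)
      then show ?thesis using 1 mono unfolding y_def[symmetric] \<delta>_def[symmetric] by simp
    next
      case 2
      have "t powi d = t ^ nat d" using 2 by (simp add: power_int_def)
      also have "\<dots> \<le> t ^ N" using t 2 by (intro power_decreasing) auto
      finally have "y * t powi d \<le> y * t ^ N" using y by simp
      then have "K * (y * t powi d) \<le> K * (t / (1 - t) * \<delta>)"
        using K ytN by (intro mult_left_mono) auto
      then have "\<bar>L1_series t y d\<bar> \<le> K * (t / (1 - t) * \<delta>)"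
        using L1_series_le_small[of y d] y by (simp add: K_def)
      then have "\<bar>L1_series t y d\<bar> / Q \<le> K * (t / (1 - t) * \<delta>) / Q"
        using Q by (intro divide_right_mono) auto
      then have "\<bar>L1_series t y d / Q\<bar> \<le> C4 * \<delta>" using Q by (simp add: C4_def)
      then show ?thesis using 2 mono unfolding y_def[symmetric] \<delta>_def[symmetric] by simp
    next
      case 3
      define P where "P = corank_mass t N s n"
      define g where "g = L1_series t y d"
      define R where "R = qpoch t t (N - n)"
      have P: "P \<ge> 0" using P0 3 by (simp add: P_def)
      have num: "\<bar>P * R - g\<bar> \<le> C2 * \<delta>"
        using corank_mass_numerator_approx[OF 3(2) s] 3
        by (simp add: P_def R_def g_def C2_def K_def \<delta>_def y_def mult.assoc)
      have g: "g \<le> K * (y * t ^ n)"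
        using L1_series_le_small[of y d] y 3 by (simp add: K_def g_def)
      have R: "Q \<le> R" "R - Q \<le> t ^ (N - n) / (1 - t)"
      proof -
        show "Q \<le> R" using qpoch_inf_le by (simp add: Q_def R_def)
        have "t ^ Suc (N - n) / (1 - t) \<le> t ^ (N - n) / (1 - t)"
          using t by (intro divide_right_mono power_decreasing) auto
        then show "R - Q \<le> t ^ (N - n) / (1 - t)"
          using qpoch_minus_qpoch_inf_le[of "N - n"] by (simp add: Q_def R_def del: power_Suc)
      qed
      \<comment> \<open>The smallness of \<open>P\<close> for small \<open>t ^ n\<close> compensates the error of order \<open>t ^ (N - n)\<close> in
        replacing \<open>R\<close> by \<open>Q\<close>.\<close>
      have PQ: "P * Q \<le> K * (y * t ^ n) + C2 * \<delta>"
        using mult_left_mono[OF R(1) P] num g by linarith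
      have "P * Q * t ^ (N - n) \<le> (K * (y * t ^ n) + C2 * \<delta>) * t ^ (N - n)"
        using PQ t by (intro mult_right_mono) auto
      also have "\<dots> = K * (y * t ^ N) + C2 * \<delta> * t ^ (N - n)"
        using 3 by (simp add: algebra_simps flip: power_add)
      also have "\<dots> \<le> K * (t / (1 - t) * \<delta>) + C2 * \<delta> * 1"
        using K ytN C2 \<delta> t by (intro add_mono mult_left_mono) (auto simp: power_le_one)
      also have "\<dots> = (K * (t / (1 - t)) + C2) * \<delta>" by (simp add: algebra_simps)
      finally have "P * t ^ (N - n) \<le> (K * (t / (1 - t)) + C2) * \<delta> / Q"
        using Q by (simp add: pos_le_divide_eq mult_ac)
      then have "P * t ^ (N - n) / (1 - t) \<le> (K * (t / (1 - t)) + C2) * \<delta> / Q / (1 - t)"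
        using t by (intro divide_right_mono) auto
      moreover have "P * (R - Q) \<le> P * (t ^ (N - n) / (1 - t))" using R P by (intro mult_left_mono) auto
      ultimately have b: "P * (R - Q) \<le> (K * (t / (1 - t)) + C2) * \<delta> / Q / (1 - t)" by simp
      have b0: "0 \<le> P * (R - Q)" using P R by simp
      \<comment> \<open>Separates the numerator error from the error in the denominator.\<close>
      have "P - g / Q = ((P * R - g) - P * (R - Q)) / Q" using Q by (simp add: field_simps)
      then have "\<bar>P - g / Q\<bar> = \<bar>(P * R - g) - P * (R - Q)\<bar> / Q" using Q by simp
      also have "\<dots> \<le> (C2 * \<delta> + (K * (t / (1 - t)) + C2) * \<delta> / Q / (1 - t)) / Q"
        using num b b0 Q by (intro divide_right_mono) linarith+
      also have "\<dots> = C3 * \<delta>" by (simp add: C3_def add_divide_distrib algebra_simps)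
      finally have "\<bar>P - g / Q\<bar> \<le> C3 * \<delta>" .
      then show ?thesis using 3 mono unfolding y_def[symmetric] \<delta>_def[symmetric] P_def g_def by simp
    qed
  qed
  then show ?thesis unfolding Q_def by blast
qed

end

subsection \<open>Inversion of the rank moments\<close>

text \<open>Passage from powers of \<open>q\<close> to those of \<open>1 / q\<close>: the factors
  telescope, and for \<open>j > r\<close> the one with \<open>i = r\<close> is 0.\<close>

lemma indep_prob_eq:
  assumes q: "q > 1"
  shows "indep_prob q r j = (if j \<le> r then qpoch (1 / q) (1 / q) r / qpoch (1 / q) (1 / q) (r - j) else 0)"
proof (cases "j \<le> r")
  case True
  have t: "0 < 1 / q" "1 / q < 1" using q by auto
  from True have "indep_prob q r j = qpoch (1 / q) (1 / q) r / qpoch (1 / q) (1 / q) (r - j)"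
  proof (induction j)
    case 0
    then show ?case using qpoch_pos[OF t, of r] by (simp add: indep_prob_def)
  next
    case (Suc j)
    then have e: "r - j = Suc (r - Suc j)" by simp
    have "1 - (1 / q) ^ (r - j) \<noteq> 0" using power_Suc_less_one[OF t, of "r - Suc j"] unfolding e by linarith
    moreover have "q ^ j / q ^ r = (1 / q) ^ (r - j)"
      using Suc q by (simp add: power_diff power_one_over)
    moreover have "qpoch (1 / q) (1 / q) (r - j) = qpoch (1 / q) (1 / q) (r - Suc j) * (1 - (1 / q) ^ (r - j))"
      unfolding e qpoch_Suc ..
    ultimately show ?case using Suc by (simp add: indep_prob_def)
  qed
  then show ?thesis using True by simp
next
  case False
  then show ?thesis using q by (auto simp: indep_prob_def intro!: bexI[of _ r])
qed

text \<open>The Cauchy product of Euler's series for $(x;t)_\<infinity>$ and for its reciprocal,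
  whose coefficients are \<open>1 / qpoch t t n\<close>.\<close>

lemma L1_coeff_convolution:
  assumes t: "0 < t" "t < 1"
  shows "(\<Sum>m\<le>n. L1_coeff t m / qpoch t t (n - m)) = (if n = 0 then 1 else 0)"
proof (cases n)
  case 0
  then show ?thesis by (simp add: L1_coeff_def qpoch_def numeral_2_eq_2)
next
  case (Suc n')
  have ch: "Suc m choose 2 = m + (m choose 2)" for m by (simp add: numeral_2_eq_2)
  have nz: "qpoch t t m \<noteq> 0" "1 - t ^ Suc m \<noteq> 0" for m
    using qpoch_pos[OF t, of m] power_Suc_less_one[OF t, of m] by simp_all
  \<comment> \<open>Closed form of the truncated sums. Here \<open>l\<close> stands for
    \<open>n' - k\<close>; at \<open>l = 0\<close> the only term left out is \<open>m = n\<close>,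
    and it cancels the closed form.\<close>
  have part: "(1 - t ^ n) * (\<Sum>m\<le>k. L1_coeff t m / qpoch t t (n - m))
      = (-1) ^ k * t ^ (Suc k choose 2) / (qpoch t t k * qpoch t t l)" if "k + l = n'" for k l
    using that
  proof (induction k arbitrary: l)
    case 0
    then have n: "n = Suc l" using Suc by simp
    show ?case using nz unfolding n by (simp add: L1_coeff_def qpoch_Suc[of t l] numeral_2_eq_2 qpoch_def[of _ _ 0])
  next
    case (Suc k)
    have IH: "(1 - t ^ n) * (\<Sum>m\<le>k. L1_coeff t m / qpoch t t (n - m))
      = (-1) ^ k * t ^ (Suc k choose 2) / (qpoch t t k * (qpoch t t l * (1 - t ^ Suc l)))"
      using Suc.IH[of "Suc l"] Suc.prems by (simp add: qpoch_Suc del: power_Suc)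
    have l: "n - Suc k = Suc l" "t ^ n = t ^ Suc k * t ^ Suc l"
      using Suc.prems \<open>n = Suc n'\<close> by (auto simp flip: power_add)
    define a b u v where "a = t ^ Suc k" and "b = t ^ Suc l"
      and "u = (-1) ^ k * t ^ (Suc k choose 2) / qpoch t t k" and "v = qpoch t t l"
    have nz': "1 - a \<noteq> 0" "1 - b \<noteq> 0" "v \<noteq> 0" unfolding a_def b_def v_def using nz by auto
    have coeff: "L1_coeff t (Suc k) = - u / (1 - a)"
      by (simp add: L1_coeff_def qpoch_Suc u_def a_def)
    have "(1 - t ^ n) * (\<Sum>m\<le>Suc k. L1_coeff t m / qpoch t t (n - m))
      = u / (v * (1 - b)) + (1 - a * b) * (- u / (1 - a) / (v * (1 - b)))"
    proof -
      have "(1 - t ^ n) * (\<Sum>m\<le>k. L1_coeff t m / qpoch t t (n - m)) = u / (v * (1 - b))"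
        unfolding IH by (simp add: u_def v_def b_def)
      moreover have "t ^ n = a * b" "qpoch t t (n - Suc k) = v * (1 - b)"
        unfolding l qpoch_Suc by (simp_all add: a_def b_def v_def)
      ultimately show ?thesis unfolding sum.atMost_Suc distrib_left coeff by simp
    qed
    also have "\<dots> = - (u * a) / ((1 - a) * v)" using nz' by (simp add: divide_simps) (simp add: algebra_simps)
    also have "\<dots> = (-1) ^ Suc k * t ^ (Suc (Suc k) choose 2) / (qpoch t t (Suc k) * qpoch t t l)"
      unfolding ch[of "Suc k"] power_add a_def u_def v_def qpoch_Suc by (simp add: mult_ac)
    finally show ?case .
  qed
  have "L1_coeff t (Suc n') = - ((-1) ^ n' * t ^ (Suc n' choose 2) / qpoch t t n') / (1 - t ^ n)"
    by (simp add: L1_coeff_def qpoch_Suc Suc)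
  then have "(1 - t ^ n) * (L1_coeff t (Suc n') / qpoch t t (n - Suc n')) = - ((-1) ^ n' * t ^ (Suc n' choose 2) / qpoch t t n')"
    using nz(2)[of n'] Suc by (simp add: qpoch_def[of _ _ 0] del: power_Suc)
  then have "(1 - t ^ n) * (\<Sum>m\<le>Suc n'. L1_coeff t m / qpoch t t (n - m)) = 0"
    using part[of n' 0] unfolding sum.atMost_Suc distrib_left by (simp add: qpoch_def[of _ _ 0])
  then show ?thesis using nz(2)[of n'] Suc by simp
qed

text \<open>The moments depend on \<open>p\<close> through a triangular matrix, since
  \<open>indep_prob q r j\<close> vanishes for \<open>j > r\<close>. The convolution identity
  supplies its inverse.\<close>

lemma moment_inversion:
  fixes p h :: "nat \<Rightarrow> real"
  assumes q: "q > 1" and t_def: "t = 1 / q"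
    and mom: "\<And>j. j \<le> N \<Longrightarrow> (\<Sum>r\<le>N. p r * indep_prob q r j) = h j"
    and r: "r \<le> N"
  shows "p r = (\<Sum>m\<le>N - r. L1_coeff t m * h (r + m)) / qpoch t t r"
proof -
  have t: "0 < t" "t < 1" using q t_def by auto
  have inner: "(\<Sum>m\<le>N - r. L1_coeff t m * indep_prob q r' (r + m)) = (if r' = r then qpoch t t r else 0)"
    if "r' \<le> N" for r'
  proof (cases "r \<le> r'")
    case True
    have "(\<Sum>m\<le>N - r. L1_coeff t m * indep_prob q r' (r + m))
      = (\<Sum>m\<le>r' - r. L1_coeff t m * (qpoch t t r' / qpoch t t (r' - r - m)))"
      by (rule sum.mono_neutral_cong_right)
         (use that True in \<open>auto simp: indep_prob_eq[OF q] t_def\<close>)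
    also have "\<dots> = qpoch t t r' * (\<Sum>m\<le>r' - r. L1_coeff t m / qpoch t t (r' - r - m))"
      by (simp add: sum_distrib_left mult_ac)
    also have "\<dots> = (if r' = r then qpoch t t r else 0)"
      unfolding L1_coeff_convolution[OF t] using True by auto
    finally show ?thesis .
  qed (auto simp: indep_prob_eq[OF q])
  have "(\<Sum>m\<le>N - r. L1_coeff t m * h (r + m))
    = (\<Sum>m\<le>N - r. L1_coeff t m * (\<Sum>r'\<le>N. p r' * indep_prob q r' (r + m)))"
    by (intro sum.cong refl) (use r mom in auto)
  also have "\<dots> = (\<Sum>r'\<le>N. p r' * (\<Sum>m\<le>N - r. L1_coeff t m * indep_prob q r' (r + m)))"
    unfolding sum_distrib_left by (subst sum.swap) (simp add: mult_ac)
  also have "\<dots> = (\<Sum>r'\<le>N. if r' = r then p r * qpoch t t r else 0)"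
    by (intro sum.cong refl) (use inner in auto)
  also have "\<dots> = p r * qpoch t t r" using r by simp
  finally show ?thesis using qpoch_pos[OF t, of r] by simp
qed

subsection \<open>Products of independent uniform matrices\<close>

lemma left_prod_cong:
  "(\<And>i. 1 \<le> i \<Longrightarrow> i \<le> k \<Longrightarrow> x i = y i) \<Longrightarrow> left_prod N x k = left_prod N y k"
  by (induction k) auto

lemma left_prod_carrier:
  "(\<And>i. 1 \<le> i \<Longrightarrow> i \<le> k \<Longrightarrow> x i \<in> carrier_mat N N) \<Longrightarrow> left_prod N x k \<in> carrier_mat N N"
  by (induction k) (auto intro!: mult_carrier_mat)

lemma (in prob_space) prob_eq_sum_count_space:
  assumes "X \<in> M \<rightarrow>\<^sub>M count_space S" "finite S"
  shows "prob {\<omega> \<in> space M. P (X \<omega>)} = (\<Sum>a\<in>S. prob {\<omega> \<in> space M. X \<omega> = a} * of_bool (P a))"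
proof -
  have X: "X \<omega> \<in> S" if "\<omega> \<in> space M" for \<omega> using measurable_space[OF assms(1) that] by simp
  have ev: "{\<omega> \<in> space M. X \<omega> = a} \<in> events" if "a \<in> S" for a
  proof -
    have "{\<omega> \<in> space M. X \<omega> = a} = X -` {a} \<inter> space M" by auto
    then show ?thesis using measurable_sets[OF assms(1), of "{a}"] that by simp
  qed
  have "{\<omega> \<in> space M. P (X \<omega>)} = (\<Union>a\<in>{a\<in>S. P a}. {\<omega> \<in> space M. X \<omega> = a})"
    using X by auto
  also have "prob \<dots> = (\<Sum>a\<in>{a\<in>S. P a}. prob {\<omega> \<in> space M. X \<omega> = a})"
    by (rule finite_measure_finite_Union) (use assms(2) ev in \<open>auto simp: disjoint_family_on_def\<close>)
  also have "\<dots> = (\<Sum>a\<in>S. prob {\<omega> \<in> space M. X \<omega> = a} * of_bool (P a))"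
    by (rule sum.mono_neutral_cong_left) (use assms(2) in auto)
  finally show ?thesis .
qed

text \<open>The situation for one fixed size \<open>N\<close>; the theorem interprets it for each
  \<open>N\<close> separately.\<close>

locale uniform_matrix_sequence = prob_space +
  fixes N :: nat and A :: "nat \<Rightarrow> 'a \<Rightarrow> 'b :: {field, finite} mat"
  assumes indep: "indep_vars (\<lambda>_. count_space (carrier_mat N N)) A {1..}"
    and unif: "i \<ge> 1 \<Longrightarrow> distr M (count_space (carrier_mat N N)) (A i) = uniform_count_measure (carrier_mat N N)"
begin

abbreviation "Mat \<equiv> carrier_mat N N :: 'b mat set"

definition prodA :: "nat \<Rightarrow> 'a \<Rightarrow> 'b mat" where
  "prodA k \<omega> = left_prod N (\<lambda>i. A i \<omega>) k"

lemma measurable_A: "i \<ge> 1 \<Longrightarrow> A i \<in> M \<rightarrow>\<^sub>M count_space Mat"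
  using indep unfolding indep_vars_def by auto

lemma prob_A_in:
  assumes "i \<ge> 1" "E \<subseteq> Mat"
  shows "prob {\<omega> \<in> space M. A i \<omega> \<in> E} = card E / card Mat"
proof -
  have "{\<omega> \<in> space M. A i \<omega> \<in> E} = A i -` E \<inter> space M" by auto
  then have "prob {\<omega> \<in> space M. A i \<omega> \<in> E} = measure (distr M (count_space Mat) (A i)) E"
    using assms measurable_A[OF assms(1)] by (simp add: measure_distr)
  also have "\<dots> = card E / card Mat"
    unfolding unif[OF assms(1)] using assms(2) by (simp add: measure_uniform_count_measure)
  finally show ?thesis .
qed

text \<open>The product of the first \<open>k\<close> matrices is a function of an index block that
  is disjoint from \<open>Suc k\<close>.\<close>

lemma indep_prodA: "indep_var (count_space Mat) (prodA k) (count_space Mat) (A (Suc k))"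
proof -
  have "indep_var (PiM {1..k} (\<lambda>_. count_space Mat)) (\<lambda>\<omega>. \<lambda>i\<in>{1..k}. A i \<omega>)
      (PiM {Suc k} (\<lambda>_. count_space Mat)) (\<lambda>\<omega>. \<lambda>i\<in>{Suc k}. A i \<omega>)"
    by (rule indep_var_restrict[OF indep]) auto
  then have "indep_var (count_space Mat) ((\<lambda>x. left_prod N x k) \<circ> (\<lambda>\<omega>. \<lambda>i\<in>{1..k}. A i \<omega>))
      (count_space Mat) ((\<lambda>x. x (Suc k)) \<circ> (\<lambda>\<omega>. \<lambda>i\<in>{Suc k}. A i \<omega>))"
  proof (rule indep_var_compose)
    \<comment> \<open>A finite product of finite discrete spaces is again discrete, so every map
      into the matrices is measurable.\<close>
    have "PiM {1..k} (\<lambda>_. count_space Mat) = count_space (PiE {1..k} (\<lambda>_. Mat))"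
      by (rule count_space_PiM_finite) (auto intro: countable_finite)
    then show "(\<lambda>x. left_prod N x k) \<in> PiM {1..k} (\<lambda>_. count_space Mat) \<rightarrow>\<^sub>M count_space Mat"
      by (auto intro!: left_prod_carrier)
  qed simp
  moreover have "(\<lambda>x. left_prod N x k) \<circ> (\<lambda>\<omega>. \<lambda>i\<in>{1..k}. A i \<omega>) = prodA k"
    unfolding prodA_def o_def by (intro ext left_prod_cong) auto
  moreover have "(\<lambda>x. x (Suc k)) \<circ> (\<lambda>\<omega>. \<lambda>i\<in>{Suc k}. A i \<omega>) = A (Suc k)" by auto
  ultimately show ?thesis by simp
qed

lemma measurable_prodA: "prodA k \<in> M \<rightarrow>\<^sub>M count_space Mat"
  using indep_prodA[of k] by (rule indep_var_rv1)

lemma prob_prodA: "prob {\<omega> \<in> space M. P (prodA k \<omega>)} = (\<Sum>B\<in>Mat. prob {\<omega> \<in> space M. prodA k \<omega> = B} * of_bool (P B))"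
  by (rule prob_eq_sum_count_space[OF measurable_prodA]) simp

section \<open>Rank moments and the exact law of the corank\<close>

text \<open>Condition on the value \<open>B\<close> of the product so far. If \<open>B\<close> keeps
  the tuple independent, the next uniform matrix does so with the same probability every time; if
  not, independence is lost for good.\<close>

lemma prob_prodA_indep_list:
  assumes ws: "ws \<in> vec_lists N j" "indep_list N ws"
  shows "prob {\<omega> \<in> space M. indep_list N (map ((*\<^sub>v) (prodA k \<omega>)) ws)} = indep_prob CARD('b) N j ^ k"
proof (induction k)
  case 0
  have "map ((*\<^sub>v) (prodA 0 \<omega>)) ws = ws" for \<omega>
    using ws(1) by (intro map_idI) (auto simp: vec_lists_def prodA_def)
  then show ?case using ws(2) by (simp add: prob_space)
next
  case (Suc k)
  let ?P = "\<lambda>B. indep_list N (map ((*\<^sub>v) B) ws)"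
  let ?E = "\<lambda>B. {C \<in> Mat. indep_list N (map ((*\<^sub>v) C) (map ((*\<^sub>v) B) ws))}"
  let ?q = "indep_prob (real CARD('b)) N j"
  have space_in: "prodA k \<omega> \<in> Mat" "A (Suc k) \<omega> \<in> Mat" if "\<omega> \<in> space M" for \<omega>
    using measurable_space[OF measurable_prodA that, of k] measurable_space[OF measurable_A that, of "Suc k"] by auto
  have ws': "map ((*\<^sub>v) B) ws \<in> vec_lists N j" if "B \<in> Mat" for B
    using map_mult_in_vec_lists[OF that ws(1)] .
  have car: "set ws \<subseteq> carrier_vec N" using ws(1) by (simp add: vec_lists_def)
  have mult: "map ((*\<^sub>v) (C * B)) ws = map ((*\<^sub>v) C) (map ((*\<^sub>v) B) ws)" if "B \<in> Mat" "C \<in> Mat" for B C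
    using car that by (auto intro!: assoc_mult_mat_vec)
  have ev: "{\<omega> \<in> space M. prodA k \<omega> = B \<and> A (Suc k) \<omega> \<in> ?E B} \<in> events"
    and pr: "prob {\<omega> \<in> space M. prodA k \<omega> = B \<and> A (Suc k) \<omega> \<in> ?E B}
      = prob {\<omega> \<in> space M. prodA k \<omega> = B} * (card (?E B) / card Mat)" if B: "B \<in> Mat" for B
  proof -
    have "{\<omega> \<in> space M. prodA k \<omega> = B \<and> A (Suc k) \<omega> \<in> ?E B}
      = (prodA k -` {B} \<inter> space M) \<inter> (A (Suc k) -` ?E B \<inter> space M)" by auto
    moreover have "prodA k -` {B} \<inter> space M \<in> events"
      by (rule measurable_sets[OF measurable_prodA]) (use B in simp)
    moreover have "A (Suc k) -` ?E B \<inter> space M \<in> events"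
      by (rule measurable_sets[OF measurable_A]) auto
    ultimately show "{\<omega> \<in> space M. prodA k \<omega> = B \<and> A (Suc k) \<omega> \<in> ?E B} \<in> events" by auto
    have "{\<omega> \<in> space M. prodA k \<omega> = B \<and> A (Suc k) \<omega> \<in> ?E B}
      = (\<lambda>\<omega>. (prodA k \<omega>, A (Suc k) \<omega>)) -` ({B} \<times> ?E B) \<inter> space M" by auto
    also have "prob \<dots> = prob (prodA k -` {B} \<inter> space M) * prob (A (Suc k) -` ?E B \<inter> space M)"
      by (rule indep_varD[OF indep_prodA]) (use B in auto)
    also have "prodA k -` {B} \<inter> space M = {\<omega> \<in> space M. prodA k \<omega> = B}" by auto
    also have "A (Suc k) -` ?E B \<inter> space M = {\<omega> \<in> space M. A (Suc k) \<omega> \<in> ?E B}" by auto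
    also have "prob \<dots> = card (?E B) / card Mat" by (rule prob_A_in) auto
    finally show "prob {\<omega> \<in> space M. prodA k \<omega> = B \<and> A (Suc k) \<omega> \<in> ?E B}
      = prob {\<omega> \<in> space M. prodA k \<omega> = B} * (card (?E B) / card Mat)" .
  qed
  have "{\<omega> \<in> space M. ?P (prodA (Suc k) \<omega>)} = (\<Union>B\<in>Mat. {\<omega> \<in> space M. prodA k \<omega> = B \<and> A (Suc k) \<omega> \<in> ?E B})"
  proof -
    have "?P (prodA (Suc k) \<omega>) \<longleftrightarrow> A (Suc k) \<omega> \<in> ?E (prodA k \<omega>)" if "\<omega> \<in> space M" for \<omega>
    proof -
      have "prodA (Suc k) \<omega> = A (Suc k) \<omega> * prodA k \<omega>" by (simp add: prodA_def)
      then have "?P (prodA (Suc k) \<omega>) \<longleftrightarrow> indep_list N (map ((*\<^sub>v) (A (Suc k) \<omega>)) (map ((*\<^sub>v) (prodA k \<omega>)) ws))"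
        by (simp only: mult[OF space_in[OF that]])
      then show ?thesis using space_in(2)[OF that] by (simp only: mem_Collect_eq simp_thms)
    qed
    then show ?thesis using space_in by auto
  qed
  also have "prob \<dots> = (\<Sum>B\<in>Mat. prob {\<omega> \<in> space M. prodA k \<omega> = B \<and> A (Suc k) \<omega> \<in> ?E B})"
    by (rule finite_measure_finite_Union) (use ev in \<open>auto simp: disjoint_family_on_def\<close>)
  also have "\<dots> = (\<Sum>B\<in>Mat. prob {\<omega> \<in> space M. prodA k \<omega> = B} * of_bool (?P B) * ?q)"
  proof (rule sum.cong[OF refl])
    fix B assume B: "B \<in> Mat"
    have "real (card (?E B)) = card Mat * (of_bool (?P B) * ?q)"
    proof (cases "?P B")
      case True
      then show ?thesis using card_mat_indep_list[OF ws'[OF B] True, of N] by simp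
    next
      case False
      have "set (map ((*\<^sub>v) B) ws) \<subseteq> carrier_vec N" using ws'[OF B] by (simp add: vec_lists_def)
      then have "?E B = {}" using indep_list_map_multD[of _ N N "map ((*\<^sub>v) B) ws"] False by blast
      then show ?thesis using False by (simp only: card.empty of_bool_eq; simp)
    qed
    moreover have "Mat \<noteq> {}" using zero_carrier_mat by blast
    ultimately show "prob {\<omega> \<in> space M. prodA k \<omega> = B \<and> A (Suc k) \<omega> \<in> ?E B}
      = prob {\<omega> \<in> space M. prodA k \<omega> = B} * of_bool (?P B) * ?q"
      unfolding pr[OF B] by simp
  qed
  also have "\<dots> = prob {\<omega> \<in> space M. ?P (prodA k \<omega>)} * ?q"
    unfolding prob_prodA[of "?P"] sum_distrib_right ..
  finally show ?case using Suc by (simp add: mult.commute)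
qed

text \<open>Average, over all \<open>j\<close>-tuples, the probability that the image is
  independent. Fixing the product first gives \<open>indep_prob\<close> at its rank. Fixing the
  tuple first gives \<open>k\<close> factors from the matrices and one more for the tuple being
  independent to begin with.\<close>

lemma rank_moment:
  "(\<Sum>r\<le>N. prob {\<omega> \<in> space M. vec_space.rank N (prodA k \<omega>) = r} * indep_prob CARD('b) r j)
    = indep_prob CARD('b) N j ^ Suc k"
proof -
  let ?q = "real CARD('b)"
  let ?p = "\<lambda>B. prob {\<omega> \<in> space M. prodA k \<omega> = B}"
  let ?I = "\<lambda>B vs. of_bool (indep_list N (map ((*\<^sub>v) B) vs)) :: real"
  let ?L = "vec_lists N j :: 'b vec list set"
  have "(\<Sum>r\<le>N. prob {\<omega> \<in> space M. vec_space.rank N (prodA k \<omega>) = r} * indep_prob ?q r j)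
    = (\<Sum>r\<le>N. \<Sum>B\<in>Mat. ?p B * of_bool (vec_space.rank N B = r) * indep_prob ?q r j)"
    unfolding prob_prodA[of "\<lambda>B. vec_space.rank N B = _"] sum_distrib_right ..
  also have "\<dots> = (\<Sum>B\<in>Mat. \<Sum>r\<le>N. ?p B * of_bool (vec_space.rank N B = r) * indep_prob ?q r j)"
    by (rule sum.swap)
  also have "\<dots> = (\<Sum>B\<in>Mat. ?p B * indep_prob ?q (vec_space.rank N B) j)"
  proof (rule sum.cong[OF refl])
    fix B :: "'b mat" assume "B \<in> Mat"
    then have "vec_space.rank N B \<le> N" by (rule vec_space.rank_le_nc)
    moreover have "(\<Sum>r\<le>N. ?p B * of_bool (vec_space.rank N B = r) * indep_prob ?q r j)
      = (\<Sum>r\<le>N. if r = vec_space.rank N B then ?p B * indep_prob ?q r j else 0)"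
      by (intro sum.cong) auto
    ultimately show "(\<Sum>r\<le>N. ?p B * of_bool (vec_space.rank N B = r) * indep_prob ?q r j)
      = ?p B * indep_prob ?q (vec_space.rank N B) j" by simp
  qed
  finally have lhs: "(\<Sum>r\<le>N. prob {\<omega> \<in> space M. vec_space.rank N (prodA k \<omega>) = r} * indep_prob ?q r j)
    = (\<Sum>B\<in>Mat. ?p B * indep_prob ?q (vec_space.rank N B) j)" .
  have cnt: "?q ^ (N * j) * indep_prob ?q (vec_space.rank N B) j = (\<Sum>vs\<in>?L. ?I B vs)" if "B \<in> Mat" for B
    using card_indep_list_map[OF that, of j] by (simp add: Int_def)
  \<comment> \<open>The number of all tuples is multiplied in, so that both sides become double sums
    over matrices and tuples.\<close>
  have "?q ^ (N * j) * (\<Sum>B\<in>Mat. ?p B * indep_prob ?q (vec_space.rank N B) j)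
    = (\<Sum>B\<in>Mat. ?p B * (?q ^ (N * j) * indep_prob ?q (vec_space.rank N B) j))"
    by (simp add: sum_distrib_left mult_ac)
  also have "\<dots> = (\<Sum>B\<in>Mat. \<Sum>vs\<in>?L. ?p B * ?I B vs)"
    by (intro sum.cong refl) (simp only: cnt sum_distrib_left)
  also have "\<dots> = (\<Sum>vs\<in>?L. prob {\<omega> \<in> space M. indep_list N (map ((*\<^sub>v) (prodA k \<omega>)) vs)})"
    unfolding prob_prodA[of "\<lambda>B. indep_list N (map ((*\<^sub>v) B) _)"] by (rule sum.swap)
  also have "\<dots> = (\<Sum>vs\<in>?L. of_bool (indep_list N vs) * indep_prob ?q N j ^ k)"
  proof (rule sum.cong[OF refl])
    fix vs assume vs: "vs \<in> ?L"
    show "prob {\<omega> \<in> space M. indep_list N (map ((*\<^sub>v) (prodA k \<omega>)) vs)} = of_bool (indep_list N vs) * indep_prob ?q N j ^ k"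
    proof (cases "indep_list N vs")
      case False
      have "\<not> indep_list N (map ((*\<^sub>v) (prodA k \<omega>)) vs)" if "\<omega> \<in> space M" for \<omega>
        using indep_list_map_multD[of "prodA k \<omega>" N N vs] measurable_space[OF measurable_prodA that, of k] vs False
        by (auto simp: vec_lists_def)
      then have "{\<omega> \<in> space M. indep_list N (map ((*\<^sub>v) (prodA k \<omega>)) vs)} = {}" by blast
      then show ?thesis using False by (simp only: measure_empty of_bool_eq; simp)
    qed (simp add: prob_prodA_indep_list[OF vs])
  qed
  also have "\<dots> = card {vs \<in> ?L. indep_list N vs} * indep_prob ?q N j ^ k"
    by (simp add: Int_def flip: sum_distrib_right)
  also have "\<dots> = ?q ^ (N * j) * indep_prob ?q N j ^ Suc k"
    unfolding card_indep_list by simp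
  finally show ?thesis unfolding lhs by simp
qed

text \<open>Inversion at rank \<open>N - d\<close>, where the sum runs up to
  \<open>N - (N - d) = d\<close>.\<close>

lemma prob_corank:
  assumes "d \<le> N"
  shows "prob {\<omega> \<in> space M. corank (prodA k \<omega>) = d} = corank_mass (1 / CARD('b)) N k d"
proof -
  let ?t = "1 / real CARD('b)"
  have q: "real CARD('b) > 1" using one_less_card_field[where 'a = 'b] by simp
  have "corank (prodA k \<omega>) = d \<longleftrightarrow> vec_space.rank N (prodA k \<omega>) = N - d" if "\<omega> \<in> space M" for \<omega>
  proof -
    have c: "prodA k \<omega> \<in> Mat" using measurable_space[OF measurable_prodA that, of k] by simp
    then have "vec_space.rank N (prodA k \<omega>) \<le> N" by (rule vec_space.rank_le_nc)
    then show ?thesis using assms c by (auto simp: corank_def)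
  qed
  then have "prob {\<omega> \<in> space M. corank (prodA k \<omega>) = d} = prob {\<omega> \<in> space M. vec_space.rank N (prodA k \<omega>) = N - d}"
    by (intro arg_cong[where f = prob]) auto
  also have "\<dots> = (\<Sum>m\<le>N - (N - d). L1_coeff ?t m * indep_prob CARD('b) N (N - d + m) ^ Suc k) / qpoch ?t ?t (N - d)"
    by (rule moment_inversion[OF q refl rank_moment]) simp
  also have "\<dots> = corank_mass ?t N k d"
  proof -
    have "indep_prob CARD('b) N (N - d + m) = qpoch ?t ?t N / qpoch ?t ?t (d - m)" if "m \<le> d" for m
    proof -
      have "N - d + m \<le> N" "N - (N - d + m) = d - m" using that assms by simp_all
      then show ?thesis by (simp add: indep_prob_eq[OF q])
    qed
    then show ?thesis unfolding corank_mass_def using assms by simp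
  qed
  finally show ?thesis .
qed

lemma prob_int_corank:
  "prob {\<omega> \<in> space M. int (corank (prodA k \<omega>)) = d}
    = (if 0 \<le> d \<and> d \<le> int N then corank_mass (1 / CARD('b)) N k (nat d) else 0)"
proof (cases "0 \<le> d \<and> d \<le> int N")
  case True
  then have "int c = d \<longleftrightarrow> c = nat d" for c by auto
  then show ?thesis using True prob_corank[of "nat d" k] nat_le_iff[of d N] by simp
next
  case False
  have "int (corank (prodA k \<omega>)) \<noteq> d" if "\<omega> \<in> space M" for \<omega>
    using measurable_space[OF measurable_prodA that, of k] False by (auto simp: corank_def)
  then have "{\<omega> \<in> space M. int (corank (prodA k \<omega>)) = d} = {}" by blast
  then show ?thesis using False by (simp only: measure_empty; simp)
qed

end


section \<open>Scaling of the limit law and convergence\<close>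

text \<open>The fractional part in the parameter offsets the integer shift exactly:
  \<open>s * t powi \<lfloor>l\<rfloor>\<close> equals \<open>p powr frac l\<close>, and
  \<open>t / (1 - t)\<close> equals \<open>1 / (p - 1)\<close>.\<close>

lemma L1_mass_eq_L1_series:
  fixes p s :: nat and x :: int and l t :: real
  assumes p: "p > 1" and s: "s > 0" and l_def: "l = log (real p) (real s)" and t_def: "t = 1 / real p"
  shows "L1_mass t (real p powr frac l / (real p - 1)) x
    = L1_series t (s * t / (1 - t)) (x + \<lfloor>l\<rfloor>) / qpoch_inf t t"
proof -
  let ?chi = "real p powr frac l / (real p - 1)"
  have t: "t \<noteq> 0" using p by (simp add: t_def)
  have "real s = real p powr l" using p s by (simp add: l_def)
  also have "\<dots> = real p powr frac l * real p powr of_int \<lfloor>l\<rfloor>"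
    by (simp add: frac_def flip: powr_add)
  also have "real p powr of_int \<lfloor>l\<rfloor> = real p powi \<lfloor>l\<rfloor>" using p by (simp add: powr_real_of_int')
  finally have sp: "real s = real p powr frac l * real p powi \<lfloor>l\<rfloor>" .
  have "t powi \<lfloor>l\<rfloor> * real p powi \<lfloor>l\<rfloor> = 1"
    using p by (simp add: t_def power_int_divide_distrib)
  then have st: "s * t powi \<lfloor>l\<rfloor> = real p powr frac l" unfolding sp by (simp add: mult_ac)
  have tp: "t / (1 - t) = 1 / (real p - 1)" using p by (simp add: t_def field_simps)
  have "s * t / (1 - t) * t powi (x + \<lfloor>l\<rfloor> - int m) = s * t powi \<lfloor>l\<rfloor> / (real p - 1) * t powi (x - int m)" for m
  proof -
    have "s * t / (1 - t) * t powi (x + \<lfloor>l\<rfloor> - int m) = s * (t / (1 - t)) * (t powi \<lfloor>l\<rfloor> * t powi (x - int m))"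
      using t by (simp add: power_int_add power_int_diff)
    then show ?thesis unfolding tp by simp
  qed
  then have "exp (- ?chi * t powi (x - int m)) = exp (- (s * t / (1 - t) * t powi (x + \<lfloor>l\<rfloor> - int m)))" for m
    unfolding st by simp
  then show ?thesis by (simp add: L1_mass_def L1_series_def L1_coeff_def mult_ac)
qed

theorem corollary1p1:
  fixes p :: nat
    and M :: "nat \<Rightarrow> 'w measure"
    and A :: "nat \<Rightarrow> nat \<Rightarrow> 'w \<Rightarrow> 'p :: prime_card mod_ring mat"
    and s :: "nat \<Rightarrow> nat"
  assumes p: "p = CARD('p)"
    and prob: "\<And>N. N \<ge> 1 \<Longrightarrow> prob_space (M N)"
    and indep: "\<And>N. N \<ge> 1 \<Longrightarrow>
      prob_space.indep_vars (M N) (\<lambda>_. count_space (carrier_mat N N)) (A N) {1..}"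
    and unif: "\<And>N i. N \<ge> 1 \<Longrightarrow> i \<ge> 1 \<Longrightarrow>
      distr (M N) (count_space (carrier_mat N N)) (A N i) = uniform_count_measure (carrier_mat N N)"
    and s_lim: "filterlim s at_top sequentially"
    and N_s_lim: "filterlim (\<lambda>N. real N - log (real p) (real (s N))) at_top sequentially"
  shows "(\<lambda>N. D_inf
      (M N) (\<lambda>\<omega>. int (corank (left_prod N (\<lambda>i. A N i \<omega>) (s N))) - \<lfloor>log (real p) (real (s N))\<rfloor>)
      (measure_pmf (L1_pmf (1 / real p)
        (real p powr frac (log (real p) (real (s N))) / (real p - 1)))) id)
    \<longlonglongrightarrow> 0"
proof -
  define t where "t = 1 / real p"
  define D where "D N = D_inf
      (M N) (\<lambda>\<omega>. int (corank (left_prod N (\<lambda>i. A N i \<omega>) (s N))) - \<lfloor>log (real p) (real (s N))\<rfloor>)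
      (measure_pmf (L1_pmf (1 / real p)
        (real p powr frac (log (real p) (real (s N))) / (real p - 1)))) id" for N
  have p1: "p > 1" using one_less_card_field[where 'a = "'p mod_ring"] by (simp add: p)
  then have t: "0 < t" "t < 1" by (simp_all add: t_def)
  obtain C where C: "\<And>N s d. 1 \<le> s \<Longrightarrow> (\<forall>d\<le>N. corank_mass t N s d \<ge> 0) \<Longrightarrow>
     \<bar>(if 0 \<le> d \<and> d \<le> int N then corank_mass t N s (nat d) else 0)
       - L1_series t (s * t / (1 - t)) d / qpoch_inf t t\<bar> \<le> C * (1 / real s + real s * t ^ N)"
    using corank_mass_approx[OF t] by blast
  have bound: "0 \<le> D N \<and> D N \<le> C * (1 / real (s N) + real (s N) * t ^ N)"
    if N: "N \<ge> 1" and sN: "s N \<ge> 1" for N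
  proof -
    define l where "l = log (real p) (real (s N))"
    define chi where "chi = real p powr frac l / (real p - 1)"
    interpret uniform_matrix_sequence "M N" N "A N"
      using prob[OF N] indep[OF N] unif[OF N]
      by (intro uniform_matrix_sequence.intro uniform_matrix_sequence_axioms.intro) auto
    have t_card: "1 / real CARD('p mod_ring) = t" by (simp add: t_def p)
    have mass: "measure (M N) {\<omega> \<in> space (M N). int (corank (left_prod N (\<lambda>i. A N i \<omega>) (s N))) - \<lfloor>l\<rfloor> = x}
      = (if 0 \<le> x + \<lfloor>l\<rfloor> \<and> x + \<lfloor>l\<rfloor> \<le> int N then corank_mass t N (s N) (nat (x + \<lfloor>l\<rfloor>)) else 0)" for x
    proof -
      have "int c - \<lfloor>l\<rfloor> = x \<longleftrightarrow> int c = x + \<lfloor>l\<rfloor>" for c by auto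
      then show ?thesis using prob_int_corank[of "s N" "x + \<lfloor>l\<rfloor>"] unfolding prodA_def t_card by simp
    qed
    \<comment> \<open>The masses are probabilities by \<open>prob_corank\<close>.\<close>
    have nonneg: "\<forall>d\<le>N. corank_mass t N (s N) d \<ge> 0"
      using prob_corank[of _ "s N"] measure_nonneg unfolding t_card by metis
    have "chi > 0" using p1 by (simp add: chi_def)
    have limit: "measure (measure_pmf (L1_pmf t chi)) {\<omega> \<in> space (measure_pmf (L1_pmf t chi)). id \<omega> = x}
      = L1_series t (s N * t / (1 - t)) (x + \<lfloor>l\<rfloor>) / qpoch_inf t t" for x
    proof -
      have "{\<omega> \<in> space (measure_pmf (L1_pmf t chi)). id \<omega> = x} = {x}" by auto
      then have "measure (measure_pmf (L1_pmf t chi)) {\<omega> \<in> space (measure_pmf (L1_pmf t chi)). id \<omega> = x} = L1_mass t chi x"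
        using pmf_L1_pmf[OF t \<open>chi > 0\<close>, of x] by (simp add: measure_pmf_single)
      then show ?thesis
        using L1_mass_eq_L1_series[OF p1 _ l_def t_def, of x] sN unfolding chi_def by simp
    qed
    let ?F = "\<lambda>x. \<bar>measure (M N) {\<omega> \<in> space (M N). int (corank (left_prod N (\<lambda>i. A N i \<omega>) (s N))) - \<lfloor>l\<rfloor> = x}
      - measure (measure_pmf (L1_pmf t chi)) {\<omega> \<in> space (measure_pmf (L1_pmf t chi)). id \<omega> = x}\<bar>"
    have le: "?F x \<le> C * (1 / real (s N) + real (s N) * t ^ N)" for x
      unfolding mass limit by (rule C[OF sN nonneg])
    have "D N = (SUP x. ?F x)"
      unfolding D_def D_inf_def t_def[symmetric] l_def[symmetric] chi_def[symmetric] ..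
    moreover have "(SUP x. ?F x) \<le> C * (1 / real (s N) + real (s N) * t ^ N)"
      by (rule cSUP_least) (simp_all only: le UNIV_not_empty not_False_eq_True)
    \<comment> \<open>A supremum of reals is meaningful only for a bounded family; the uniform bound
      provides this.\<close>
    moreover have "0 \<le> (SUP x. ?F x)"
      by (rule cSUP_upper2[of _ _ 0]) (use le in \<open>auto intro!: bdd_aboveI2\<close>)
    ultimately show ?thesis by simp
  qed
  have s1: "\<forall>\<^sub>F N in sequentially. s N \<ge> 1" using s_lim by (simp add: filterlim_at_top)
  have ev: "\<forall>\<^sub>F N in sequentially. 0 \<le> D N \<and> D N \<le> C * (1 / real (s N) + real (s N) * t ^ N)"
    using s1 eventually_ge_at_top[of 1] by eventually_elim (rule bound)
  have "filterlim (\<lambda>N. real (s N)) at_top sequentially"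
    by (rule filterlim_compose[OF filterlim_real_sequentially s_lim])
  then have l1: "(\<lambda>N. 1 / real (s N)) \<longlonglongrightarrow> 0"
    by (simp add: divide_inverse tendsto_inverse_0_at_top)
  have "filterlim (\<lambda>N. - (ln p * (real N - log (real p) (real (s N))))) at_bot sequentially"
    using p1 by (intro filterlim_compose[OF filterlim_uminus_at_bot_at_top]
        filterlim_tendsto_pos_mult_at_top[OF tendsto_const _ N_s_lim]) auto
  then have "(\<lambda>N. exp (- (ln p * (real N - log (real p) (real (s N)))))) \<longlonglongrightarrow> 0"
    by (rule filterlim_compose[OF exp_at_bot])
  moreover have "\<forall>\<^sub>F N in sequentially. exp (- (ln p * (real N - log (real p) (real (s N))))) = real (s N) * t ^ N"
    using s1
  proof eventually_elim
    case (elim N)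
    have "- (ln p * (real N - log (real p) (real (s N)))) = ln (real (s N)) - real N * ln p"
      using p1 by (simp add: log_def algebra_simps)
    then show ?case using elim p1
      by (simp add: exp_diff exp_of_nat_mult t_def power_one_over)
  qed
  ultimately have l2: "(\<lambda>N. real (s N) * t ^ N) \<longlonglongrightarrow> 0"
    by (rule Lim_transform_eventually)
  have "(\<lambda>N. C * (1 / real (s N) + real (s N) * t ^ N)) \<longlonglongrightarrow> C * (0 + 0)"
    by (intro tendsto_intros l1 l2)
  then have "(\<lambda>N. C * (1 / real (s N) + real (s N) * t ^ N)) \<longlonglongrightarrow> 0" by simp
  then have "D \<longlonglongrightarrow> 0"
    by (rule tendsto_sandwich[rotated 2, OF tendsto_const]) (use ev in \<open>auto elim: eventually_mono\<close>)
  then show ?thesis unfolding D_def .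
qed

end
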